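(* The problem $NL_C$ is $\#\mathbf{P}$-hard, where $NL_C$ is: given an XOR-AND circuit $C$ and a target $s\in\mathbb{N}$, decide whether $NL(f_C)\le s$.
   Context: An XOR-AND circuit is a Boolean circuit with fan-in 2 over the basis $(\land,\oplus,1)$ (arithmetic over $\mathbb{F}_2$); $f_C:\mathbb{F}_2^n\to\mathbb{F}_2$ is the function computed by a circuit $C$ with $n$ inputs. The nonlinearity of $f:\mathbb{F}_2^n\to\mathbb{F}_2$ is its Hamming distance to the closest affine function: $NL(f)=2^n-\max_{\mathbf{a}\in\mathbb{F}_2^n,c\in\mathbb{F}_2}|\{\mathbf{x}\in\mathbb{F}_2^n : f(\mathbf{x})=\mathbf{a}\cdot\mathbf{x}+c\}|$. *)

theory Defs
  imports Complex_Main "HOL-Library.Z2" "HOL-Computational_Algebra.Polynomial"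
begin

section \<open>XOR-AND circuits and nonlinearity\<close>

text \<open>
  \<open>\<F>\<^sub>2\<close> is the library field \<open>bit\<close>; \<open>\<F>\<^sub>2\<^sup>n\<close> is the set of lists of length \<open>n\<close>.
\<close>

definition F2 :: "nat \<Rightarrow> bit list set" where
  "F2 n = {x. length x = n}"

definition dot :: "bit list \<Rightarrow> bit list \<Rightarrow> bit" where
  "dot a x = (\<Sum>i<length x. a ! i * x ! i)"

definition nonlinearity :: "nat \<Rightarrow> (bit list \<Rightarrow> bit) \<Rightarrow> nat" where
  "nonlinearity n f =
     2 ^ n - Max {card {x \<in> F2 n. f x = dot a x + c} | a c. a \<in> F2 n}"

text \<open>
  A circuit is given by its gates in topological order. Wires \<open>0, \<dots>, n - 1\<close> are the
  inputs and wire \<open>n + k\<close> is the output of the \<open>k\<close>-th gate.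
\<close>

datatype gate = One | And nat nat | Xor nat nat

record circuit =
  inputs :: nat
  gates :: "gate list"
  out_wire :: nat

fun gate_ok :: "nat \<Rightarrow> gate \<Rightarrow> bool" where
  "gate_ok m One \<longleftrightarrow> True"
| "gate_ok m (And i j) \<longleftrightarrow> i < m \<and> j < m"
| "gate_ok m (Xor i j) \<longleftrightarrow> i < m \<and> j < m"

definition wf_circuit :: "circuit \<Rightarrow> bool" where
  "wf_circuit C \<longleftrightarrow>
     (\<forall>k < length (gates C). gate_ok (inputs C + k) (gates C ! k)) \<and>
     out_wire C < inputs C + length (gates C)"

fun gate_val :: "bit list \<Rightarrow> gate \<Rightarrow> bit" where
  "gate_val vs One = 1"
| "gate_val vs (And i j) = vs ! i * vs ! j"
| "gate_val vs (Xor i j) = vs ! i + vs ! j"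

definition wire_vals :: "gate list \<Rightarrow> bit list \<Rightarrow> bit list" where
  "wire_vals gs x = foldl (\<lambda>vs g. vs @ [gate_val vs g]) x gs"

definition circuit_fun :: "circuit \<Rightarrow> bit list \<Rightarrow> bit" where
  "circuit_fun C x = wire_vals (gates C) x ! out_wire C"


section \<open>Encodings as bit strings\<close>

text \<open>Binary representation, least significant bit first, without leading zeros.\<close>

fun nat_bits :: "nat \<Rightarrow> bool list" where
  "nat_bits n = (if n = 0 then [] else odd n # nat_bits (n div 2))"

declare nat_bits.simps [simp del]

text \<open>
  The number of inputs and the wire numbers of a circuit are written in unary. As a
  circuit has one node per input and per gate, this is polynomially related to any other
  standard encoding. The target, which may be exponential in the number of inputs, is
  written in binary.
\<close>

definition unary :: "nat \<Rightarrow> bool list" where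
  "unary n = replicate n True @ [False]"

fun enc_gate :: "gate \<Rightarrow> bool list" where
  "enc_gate One = [False, False]"
| "enc_gate (And i j) = [True, False] @ unary i @ unary j"
| "enc_gate (Xor i j) = [True, True] @ unary i @ unary j"

definition enc_circuit :: "circuit \<Rightarrow> bool list" where
  "enc_circuit C =
     unary (inputs C) @ unary (length (gates C)) @ concat (map enc_gate (gates C)) @
     unary (out_wire C)"

definition enc_instance :: "circuit \<Rightarrow> nat \<Rightarrow> bool list" where
  "enc_instance C s = enc_circuit C @ nat_bits s"

definition enc_pair :: "bool list \<Rightarrow> bool list \<Rightarrow> bool list" where
  "enc_pair x y = concat (map (\<lambda>b. [True, b]) x) @ [False] @ y"

lemma enc_pair_inject: "enc_pair x y = enc_pair x' y' \<longleftrightarrow> x = x' \<and> y = y'"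
proof (induction x arbitrary: x')
  case Nil
  show ?case by (cases x') (auto simp: enc_pair_def)
next
  case (Cons b x)
  then show ?case by (cases x') (auto simp: enc_pair_def)
qed

lemma nat_bits_inject: "nat_bits m = nat_bits n \<longleftrightarrow> m = n"
proof (induction m arbitrary: n rule: less_induct)
  case (less m)
  show ?case
  proof (cases "m = 0 \<or> n = 0")
    case True
    then show ?thesis by (auto simp: nat_bits.simps[of m] nat_bits.simps[of n])
  next
    case False
    then have "nat_bits m = nat_bits n \<longleftrightarrow> odd m = odd n \<and> m div 2 = n div 2"
      using less.IH[of "m div 2" "n div 2"]
      by (auto simp: nat_bits.simps[of m] nat_bits.simps[of n])
    also have "\<dots> \<longleftrightarrow> m = n"
      by (metis bit_eq_rec even_iff_mod_2_eq_zero)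
    finally show ?thesis .
  qed
qed

lemma unary_append_inject: "unary m @ u = unary n @ v \<longleftrightarrow> m = n \<and> u = v"
proof (induction m arbitrary: n)
  case 0
  show ?case by (cases n) (auto simp: unary_def)
next
  case (Suc m)
  then show ?case by (cases n) (auto simp: unary_def)
qed

lemma enc_gate_append_inject: "enc_gate g @ u = enc_gate h @ v \<longleftrightarrow> g = h \<and> u = v"
  by (cases g; cases h) (auto simp: unary_append_inject)

lemma enc_gates_append_inject:
  "length gs = length hs \<Longrightarrow>
   concat (map enc_gate gs) @ u = concat (map enc_gate hs) @ v \<longleftrightarrow> gs = hs \<and> u = v"
  by (induction gs hs rule: list_induct2) (auto simp: enc_gate_append_inject)

lemma enc_instance_inject: "enc_instance C s = enc_instance D t \<longleftrightarrow> C = D \<and> s = t"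
proof
  assume "enc_instance C s = enc_instance D t"
  then have "inputs C = inputs D" and len: "length (gates C) = length (gates D)"
    and "concat (map enc_gate (gates C)) @ unary (out_wire C) @ nat_bits s =
         concat (map enc_gate (gates D)) @ unary (out_wire D) @ nat_bits t"
    by (auto simp: enc_instance_def enc_circuit_def unary_append_inject)
  then show "C = D \<and> s = t"
    by (auto simp: enc_gates_append_inject[OF len] unary_append_inject nat_bits_inject)
qed simp

definition NL_C :: "bool list set" where
  "NL_C = {enc_instance C s | C s.
             wf_circuit C \<and> nonlinearity (inputs C) (circuit_fun C) \<le> s}"


section \<open>Oracle Turing machines\<close>

text \<open>
  Deterministic multi-tape machines over the tape alphabet \<open>{0, 1, blank}\<close>, with blank
  represented by \<open>None\<close>. Tapes are infinite in both directions. Tape 0 holds the input,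
  tape 1 the output and tape 2 the oracle query; any further tapes are work tapes.
  The fields \<open>next_state\<close>, \<open>write_sym\<close> and \<open>move_dir\<close> are the components of the
  transition function: they take the current state and the list of the \<open>ntapes\<close> scanned
  symbols, and the latter two also the number of the tape acted upon. Only their values at
  states below \<open>nstates\<close>, lists of length \<open>ntapes\<close> and tapes below \<open>ntapes\<close> matter, so
  that a machine is a finite table.
\<close>

type_synonym sym = "bool option"

datatype dir = MoveL | Stay | MoveR

record otm =
  ntapes :: nat
  nstates :: nat
  next_state :: "nat \<Rightarrow> sym list \<Rightarrow> nat"
  write_sym :: "nat \<Rightarrow> sym list \<Rightarrow> nat \<Rightarrow> sym"
  move_dir :: "nat \<Rightarrow> sym list \<Rightarrow> nat \<Rightarrow> dir"

record config =
  state :: nat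
  tape :: "nat \<Rightarrow> int \<Rightarrow> sym"
  head :: "nat \<Rightarrow> int"

abbreviation (input) "q_start \<equiv> 0 :: nat"
abbreviation (input) "q_halt \<equiv> 1 :: nat"
abbreviation (input) "q_query \<equiv> 2 :: nat"
abbreviation (input) "q_yes \<equiv> 3 :: nat"
abbreviation (input) "q_no \<equiv> 4 :: nat"

definition wf_otm :: "otm \<Rightarrow> bool" where
  "wf_otm M \<longleftrightarrow> ntapes M \<ge> 3 \<and> nstates M \<ge> 5 \<and>
     (\<forall>q < nstates M. \<forall>w. length w = ntapes M \<longrightarrow> next_state M q w < nstates M)"

text \<open>The bit string written from cell 0 up to, but excluding, the first blank.\<close>

definition tape_word :: "(int \<Rightarrow> sym) \<Rightarrow> bool list" where
  "tape_word t = map (\<lambda>i. the (t (int i))) [0..<(LEAST n. t (int n) = None)]"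

definition word_tape :: "bool list \<Rightarrow> int \<Rightarrow> sym" where
  "word_tape x i = (if 0 \<le> i \<and> i < int (length x) then Some (x ! nat i) else None)"

definition init_config :: "bool list \<Rightarrow> config" where
  "init_config x = \<lparr> state = q_start,
     tape = (\<lambda>k. if k = 0 then word_tape x else (\<lambda>_. None)), head = (\<lambda>_. 0) \<rparr>"

fun dir_offset :: "dir \<Rightarrow> int" where
  "dir_offset MoveL = -1"
| "dir_offset Stay = 0"
| "dir_offset MoveR = 1"

definition scanned :: "otm \<Rightarrow> config \<Rightarrow> sym list" where
  "scanned M c = map (\<lambda>k. tape c k (head c k)) [0..<ntapes M]"

text \<open>
  A query is answered in one step, by passing to \<open>q_yes\<close> or \<open>q_no\<close>, and leaves the
  tapes and the heads as they are.
\<close>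

definition step :: "otm \<Rightarrow> bool list set \<Rightarrow> config \<Rightarrow> config" where
  "step M A c =
    (if state c = q_halt then c
     else if state c = q_query then
       c\<lparr> state := if tape_word (tape c 2) \<in> A then q_yes else q_no \<rparr>
     else let w = scanned M c in
       \<lparr> state = next_state M (state c) w,
         tape = (\<lambda>k. if k < ntapes M
                     then (tape c k)(head c k := write_sym M (state c) w k) else tape c k),
         head = (\<lambda>k. if k < ntapes M
                     then head c k + dir_offset (move_dir M (state c) w k) else head c k) \<rparr>)"

text \<open>Once the halting state is reached, the configuration no longer changes.\<close>

definition computes_within :: "otm \<Rightarrow> bool list set \<Rightarrow> bool list \<Rightarrow> nat \<Rightarrow> bool list \<Rightarrow> bool" where
  "computes_within M A x t y \<longleftrightarrow>
     (let c = (step M A ^^ t) (init_config x)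
      in state c = q_halt \<and> tape_word (tape c 1) = y)"

section \<open>Polynomial time, the class \<open>#P\<close> and \<open>#P\<close>-hardness\<close>

definition FP_oracle :: "bool list set \<Rightarrow> (bool list \<Rightarrow> bool list) set" where
  "FP_oracle A = {f. \<exists>M (p :: nat poly). wf_otm M \<and>
     (\<forall>x. computes_within M A x (poly p (length x)) (f x))}"

text \<open>A machine without oracle is a machine with the empty oracle.\<close>

definition P_class :: "bool list set set" where
  "P_class = {L. (\<lambda>x. [x \<in> L]) \<in> FP_oracle {}}"

definition sharpP :: "(bool list \<Rightarrow> nat) set" where
  "sharpP = {f. \<exists>V \<in> P_class. \<exists>p :: nat poly. \<forall>x.
     f x = card {y. length y = poly p (length x) \<and> enc_pair x y \<in> V}}"

text \<open>
  Hardness of a decision problem for the function class \<open>#P\<close> is with respect to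
  polynomial-time Turing reductions.
\<close>

definition sharpP_hard :: "bool list set \<Rightarrow> bool" where
  "sharpP_hard L \<longleftrightarrow> (\<forall>f \<in> sharpP. (\<lambda>x. nat_bits (f x)) \<in> FP_oracle L)"

end

theory Submission
  imports Defs
begin

text \<open>
  Let \<open>f\<close> count the witnesses \<open>y\<close> of length \<open>m\<close> accepted together with \<open>x\<close> by a polynomial-time
  machine. A circuit simulating the machine, with two further inputs \<open>z\<^sub>1, z\<^sub>2\<close>, computes
  \<open>V(x, y) z\<^sub>1 z\<^sub>2\<close>. This function has weight \<open>f x\<close>, at most a quarter of the cube, so zero is its
  closest affine function and its nonlinearity is \<open>f x\<close>. Queries to \<open>NL_C\<close> therefore compare
  \<open>f x\<close> with arbitrary numbers, and a binary search finds \<open>f x\<close>.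

  In the circuit, the tapes move instead of the heads, so that the configuration after \<open>t\<close> steps is
  a row of cells in which a cell depends only on three neighbouring cells and the central cell of
  the previous row. Every cell is a copy of one fixed gadget, hence the wire numbers are
  polynomials in the row and the column, and the code of the circuit is written by nested
  loops over counters.
\<close>

section \<open>Functions of small weight\<close>

text \<open>Without \<open>z1\<close> and \<open>z2\<close> a verifier with many witnesses could lie
  nearer to another affine function, and the distance would no longer be the number of witnesses.
  Hardness is stated for machine tables with polynomial clocks, so the reduction must be exhibited
  as such a table. Two constraints shape it. A machine returns from a query in one of two fixed
  states and forgets where it asked; a program with a single query instruction inside a loop avoids
  the problem, and binary search is of this kind. Moreover, a machine can only print a circuit whose
  wire numbers it can compute with counters. This is why all blocks of the tableau have the same
  length and why the head is held in a fixed column: addresses become polynomials into which the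
  position of the head never enters. The code of an instance ends with the target, lowest digit
  first. Hence the circuit is printed once, and each round of the search writes only a single cell
  of the query tape.\<close>

declare add_bit_eq_xor [simp del] mult_bit_eq_and [simp del]

lemma bit_add_self [simp]: "b + b = (0 :: bit)"
  by (cases b) simp_all

lemma F2_eq: "F2 n = {x. set x \<subseteq> UNIV \<and> length x = n}"
  by (simp add: F2_def)

lemma UNIV_bit: "(UNIV :: bit set) = {0, 1}"
  by (metis (full_types) UNIV_eq_I bit_not_zero_iff insert_iff)

lemma finite_F2 [simp]: "finite (F2 n)"
  unfolding F2_eq by (rule finite_lists_length_eq) (simp add: UNIV_bit)

lemma card_F2: "card (F2 n) = 2 ^ n"
  unfolding F2_eq by (subst card_lists_length_eq) (simp_all add: UNIV_bit numeral_2_eq_2)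

lemma dot_flip:
  assumes "i < length x" "a ! i = 1"
  shows "dot a (x[i := x ! i + 1]) = dot a x + 1"
proof -
  have "dot a (x[i := x ! i + 1]) = (\<Sum>j<length x. a ! j * x ! j + of_bool (j = i))"
    unfolding dot_def
    by (rule sum.cong) (use assms in \<open>auto simp: nth_list_update\<close>)
  also have "\<dots> = dot a x + 1"
    using assms by (simp add: dot_def sum.distrib of_bool_def)
  finally show ?thesis .
qed

text \<open>Flipping a coordinate with coefficient 1 maps the zeros injectively to nonzeros. If
  there is no such coordinate, the function is the constant \<open>c = 1\<close> and has no
  zeros.\<close>

lemma affine_zeros_le:
  assumes "a \<in> F2 n" and "c = 1 \<or> (\<exists>i<n. a ! i = 1)"
  shows "2 * card {x \<in> F2 n. dot a x + c = 0} \<le> 2 ^ n"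
proof -
  let ?Z = "{x \<in> F2 n. dot a x + c = 0}"
  have "card ?Z \<le> card (F2 n - ?Z)"
  proof (cases "\<exists>i<n. a ! i = 1")
    case True
    then obtain i where i: "i < n" "a ! i = 1" by blast
    let ?f = "\<lambda>x::bit list. x[i := x ! i + 1]"
    have "inj_on ?f ?Z"
    proof (rule inj_on_inverseI)
      fix x assume "x \<in> ?Z"
      then show "?f (?f x) = x" using i
        by (auto simp: F2_def intro!: nth_equalityI simp: nth_list_update add.assoc)
    qed
    moreover have "?f ` ?Z \<subseteq> F2 n - ?Z"
    proof -
      have "dot a (?f x) + c \<noteq> 0" if "x \<in> ?Z" for x
      proof -
        have "dot a (?f x) + c = (dot a x + c) + 1"
          using that i by (simp add: F2_def dot_flip)
        then show ?thesis using that by simp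
      qed
      then show ?thesis by (auto simp: F2_def)
    qed
    ultimately show ?thesis
      by (meson card_inj_on_le finite_Diff finite_F2)
  next
    case False
    then have "a ! i = 0" if "i < n" for i using that by (meson bit_not_zero_iff)
    then have "dot a x = 0" if "x \<in> F2 n" for x
      using that by (simp add: dot_def F2_def)
    then have "?Z = {}" using assms False by auto
    then show ?thesis by (metis card.empty le0)
  qed
  moreover have "card (F2 n - ?Z) = 2 ^ n - card ?Z"
    by (subst card_Diff_subset) (auto simp: card_F2)
  ultimately show ?thesis by linarith
qed

text \<open>A nonzero affine function has weight at least half of the cube, so a function of weight at
  most a quarter has no closer affine function than zero.\<close>

lemma nonlinearity_of_small_weight:
  assumes "4 * card {x \<in> F2 n. f x = 1} \<le> 2 ^ n"
  shows "nonlinearity n f = card {x \<in> F2 n. f x = 1}"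
proof -
  let ?S = "{x \<in> F2 n. f x = 1}"
  let ?A = "{card {x \<in> F2 n. f x = dot a x + c} | a c. a \<in> F2 n}"
  have "Max ?A = 2 ^ n - card ?S"
  proof (rule Max_eqI)
    have "?A \<subseteq> {..2 ^ n}"
      by (auto simp: card_F2[symmetric] intro!: card_mono)
    then show "finite ?A" by (rule finite_subset) simp
    show "y \<le> 2 ^ n - card ?S" if "y \<in> ?A" for y
    proof -
      from that obtain a c where a: "a \<in> F2 n"
        and y: "y = card {x \<in> F2 n. f x = dot a x + c}" by blast
      show ?thesis
      proof (cases "c = 1 \<or> (\<exists>i<n. a ! i = 1)")
        case True
        \<comment> \<open>Agreement outside the support of \<open>f\<close> forces the affine
          function to be 0 there. So they agree on at most half plus a quarter of the cube, while
          \<open>f\<close> agrees with 0 on at least three quarters.\<close>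
        have "{x \<in> F2 n. f x = dot a x + c} \<subseteq> {x \<in> F2 n. dot a x + c = 0} \<union> ?S"
          using bit_not_zero_iff by auto
        then have "y \<le> card ({x \<in> F2 n. dot a x + c = 0} \<union> ?S)"
          unfolding y by (intro card_mono) auto
        also have "\<dots> \<le> card {x \<in> F2 n. dot a x + c = 0} + card ?S"
          by (rule card_Un_le)
        finally show ?thesis
          using affine_zeros_le[OF a True] assms by linarith
      next
        case False
        then have "a ! i = 0" if "i < n" for i using that by (meson bit_not_zero_iff)
        then have "dot a x = 0" if "x \<in> F2 n" for x
          using that by (simp add: dot_def F2_def)
        then have "{x \<in> F2 n. f x = dot a x + c} = F2 n - ?S"
          using False bit_not_zero_iff by auto
        then show ?thesis unfolding y
          by (simp add: card_Diff_subset card_F2)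
      qed
    qed
    have "dot (replicate n 0) x = 0" if "x \<in> F2 n" for x
      using that by (simp add: dot_def F2_def)
    then have "F2 n - ?S = {x \<in> F2 n. f x = dot (replicate n 0) x + 0}"
      using bit_not_zero_iff by auto
    moreover have "card (F2 n - ?S) = 2 ^ n - card ?S"
      by (subst card_Diff_subset) (auto simp: card_F2)
    moreover have "replicate n 0 \<in> F2 n" by (simp add: F2_def)
    ultimately show "2 ^ n - card ?S \<in> ?A"
      by (intro CollectI exI[of _ "replicate n 0"] exI[of _ 0]) simp
  qed
  moreover have "card ?S \<le> 2 ^ n"
    using assms by linarith
  ultimately show ?thesis by (simp add: nonlinearity_def)
qed

text \<open>Appending two ones to a witness is a bijection onto the support. At most
  \<open>2 ^ m\<close> of the \<open>2 ^ (m + 2)\<close> points have this form, which is the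
  required quarter.\<close>

lemma nonlinearity_eq_count:
  assumes f: "\<And>y z1 z2. length y = m \<Longrightarrow>
     f (map of_bool y @ [z1, z2]) = of_bool (P y) * z1 * z2"
  shows "nonlinearity (m + 2) f = card {y :: bool list. length y = m \<and> P y}" (is "_ = card ?Y")
proof -
  let ?S = "{x \<in> F2 (m + 2). f x = 1}"
  let ?h = "\<lambda>y. map of_bool y @ [1, 1 :: bit]"
  have "bij_betw ?h ?Y ?S"
  proof (rule bij_betwI')
    show "(?h x = ?h y) = (x = y)" for x y
      by (auto simp: inj_map_eq_map inj_on_def)
    show "?h y \<in> ?S" if "y \<in> ?Y" for y using that f by (simp add: F2_def)
    show "\<exists>y\<in>?Y. x = ?h y" if x: "x \<in> ?S" for x
    proof -
      define y where "y = map (\<lambda>b. b = 1) (take m x)"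
      have len: "length x = m + 2" using x by (simp add: F2_def)
      have "map of_bool (map (\<lambda>b. b = 1) u) = u" for u :: "bit list"
        using bit_not_zero_iff by (auto intro!: map_idI simp: of_bool_def)
      then have "take m x = map of_bool y" unfolding y_def by metis
      moreover obtain z1 z2 where "drop m x = [z1, z2]"
        using len by (metis add_diff_cancel_left' length_drop length_0_conv length_Suc_conv numeral_2_eq_2)
      ultimately have xy: "x = map of_bool y @ [z1, z2]" by (metis append_take_drop_id)
      have ly: "length y = m" using len by (simp add: y_def)
      with x xy f have "of_bool (P y) * z1 * z2 = 1" by simp
      then have "P y" "z1 = 1" "z2 = 1" 
        by (cases z1; cases z2; auto simp: of_bool_def split: if_splits)+
      with xy ly show ?thesis by auto
    qed
  qed
  then have eq: "card ?Y = card ?S" by (rule bij_betw_same_card)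
  have "card ?Y \<le> card {y :: bool list. set y \<subseteq> UNIV \<and> length y = m}"
    by (intro card_mono finite_lists_length_eq) auto
  then have "card ?Y \<le> 2 ^ m" by (subst (asm) card_lists_length_eq) simp_all
  then have "4 * card ?S \<le> 2 ^ (m + 2)" using eq by simp
  then show ?thesis using eq nonlinearity_of_small_weight[of "m + 2" f] by simp
qed


section \<open>Circuit templates\<close>

lemma length_wire_vals [simp]: "length (wire_vals gs x) = length x + length gs"
  unfolding wire_vals_def by (induction gs arbitrary: x) auto

lemma wire_vals_append: "wire_vals (gs @ hs) x = wire_vals hs (wire_vals gs x)"
  by (simp add: wire_vals_def)

lemma wire_vals_Cons: "wire_vals (g # gs) x = wire_vals gs (x @ [gate_val x g])"
  by (simp add: wire_vals_def)

lemma wire_vals_nth: "i < length x \<Longrightarrow> wire_vals gs x ! i = x ! i"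
  by (induction gs arbitrary: x) (simp_all add: wire_vals_def nth_append)

lemma gate_val_cong:
  assumes "gate_ok k g" "\<And>i. i < k \<Longrightarrow> u ! i = v ! i"
  shows "gate_val u g = gate_val v g"
  using assms by (cases g) simp_all

text \<open>A gate reads only earlier wires, and later gates never change them. So the finished list
  of values satisfies the equation of every gate, and circuits can be analysed through these
  equations alone.\<close>

lemma wire_vals_gate:
  assumes "k < length gs" "gate_ok (length x + k) (gs ! k)"
  shows "wire_vals gs x ! (length x + k) = gate_val (wire_vals gs x) (gs ! k)"
proof -
  define u where "u = wire_vals (take k gs) x"
  have u: "length u = length x + k" using assms by (simp add: u_def)
  have "gs = take k gs @ gs ! k # drop (Suc k) gs"
    using assms(1) by (rule id_take_nth_drop)
  then have eq: "wire_vals gs x = wire_vals (drop (Suc k) gs) (u @ [gate_val u (gs ! k)])"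
    unfolding u_def by (metis wire_vals_append wire_vals_Cons)
  have "gate_val u (gs ! k) = gate_val (wire_vals gs x) (gs ! k)"
    by (rule gate_val_cong[OF assms(2)]) (simp add: eq wire_vals_nth nth_append u)
  then show ?thesis
    by (simp add: eq wire_vals_nth nth_append u)
qed

text \<open>A port \<open>(j, o)\<close> of a template denotes wire \<open>o\<close> relative to the \<open>j\<close>-th base address.
  Base 4 is the address of the template itself.\<close>

type_synonym port = "nat \<times> nat"

datatype tgate = TOne | TAnd port port | TXor port port

definition wire :: "(nat \<Rightarrow> nat) \<Rightarrow> port \<Rightarrow> nat" where
  "wire b p = b (fst p) + snd p"

fun inst :: "(nat \<Rightarrow> nat) \<Rightarrow> tgate \<Rightarrow> gate" where
  "inst b TOne = One"
| "inst b (TAnd p q) = And (wire b p) (wire b q)"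
| "inst b (TXor p q) = Xor (wire b p) (wire b q)"

fun ports :: "tgate \<Rightarrow> port set" where
  "ports TOne = {}"
| "ports (TAnd p q) = {p, q}"
| "ports (TXor p q) = {p, q}"

lemma gate_ok_inst: "gate_ok k (inst b g) \<longleftrightarrow> (\<forall>p\<in>ports g. wire b p < k)"
  by (cases g) auto

section \<open>Compiling Boolean expressions into templates\<close>

datatype bexp = BOne | BVar port | BAnd bexp bexp | BXor bexp bexp

fun beval :: "(port \<Rightarrow> bit) \<Rightarrow> bexp \<Rightarrow> bit" where
  "beval \<rho> BOne = 1"
| "beval \<rho> (BVar p) = \<rho> p"
| "beval \<rho> (BAnd e f) = beval \<rho> e * beval \<rho> f"
| "beval \<rho> (BXor e f) = beval \<rho> e + beval \<rho> f"

fun bvars :: "bexp \<Rightarrow> port set" where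
  "bvars BOne = {}"
| "bvars (BVar p) = {p}"
| "bvars (BAnd e f) = bvars e \<union> bvars f"
| "bvars (BXor e f) = bvars e \<union> bvars f"

text \<open>The code of an expression starts at offset \<open>s\<close> of the template and leaves
  the value on its last wire. A variable is copied by an AND with itself, as squaring is the
  identity.\<close>

fun bcomp :: "nat \<Rightarrow> bexp \<Rightarrow> tgate list" where
  "bcomp s BOne = [TOne]"
| "bcomp s (BVar p) = [TAnd p p]"
| "bcomp s (BAnd e f) =
     (let c = bcomp s e; d = bcomp (s + length c) f
      in c @ d @ [TAnd (4, s + length c - 1) (4, s + length c + length d - 1)])"
| "bcomp s (BXor e f) =
     (let c = bcomp s e; d = bcomp (s + length c) f
      in c @ d @ [TXor (4, s + length c - 1) (4, s + length c + length d - 1)])"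

lemma bcomp_nonempty: "0 < length (bcomp s e)"
  by (cases e) (auto simp: Let_def)

lemma all_less_add:
  "(\<forall>i<(a :: nat) + b. P i) \<longleftrightarrow> (\<forall>i<a. P i) \<and> (\<forall>i<b. P (a + i))" (is "?l \<longleftrightarrow> ?r")
proof
  assume r: ?r
  show ?l
  proof (intro allI impI)
    fix i assume "i < a + b"
    then show "P i" using r by (cases "i < a") (auto dest!: spec[of _ "i - a"])
  qed
qed auto

definition ports_ok :: "port set \<Rightarrow> nat \<Rightarrow> tgate list \<Rightarrow> bool" where
  "ports_ok X s c \<longleftrightarrow> (\<forall>i<length c. ports (c ! i) \<subseteq> X \<union> {4} \<times> {..<s + i})"

lemma ports_ok_append:
  "ports_ok X s (c @ d) \<longleftrightarrow> ports_ok X s c \<and> ports_ok X (s + length c) d"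
  unfolding ports_ok_def by (simp add: all_less_add nth_append add.assoc)

lemma ports_ok_single: "ports_ok X s [g] \<longleftrightarrow> ports g \<subseteq> X \<union> {4} \<times> {..<s}"
  by (simp add: ports_ok_def)

lemma ports_ok_bcomp: "bvars e \<subseteq> X \<Longrightarrow> ports_ok X s (bcomp s e)"
proof (induction e arbitrary: s)
  case (BAnd e f)
  let ?c = "bcomp s e" and ?d = "bcomp (s + length (bcomp s e)) f"
  have "s + length ?c - 1 < s + (length ?c + length ?d)"
    "s + length ?c + length ?d - 1 < s + (length ?c + length ?d)"
    using bcomp_nonempty[of s e] by linarith+
  with BAnd show ?case
    by (simp add: Let_def ports_ok_append ports_ok_single add.assoc)
next
  case (BXor e f)
  let ?c = "bcomp s e" and ?d = "bcomp (s + length (bcomp s e)) f"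
  have "s + length ?c - 1 < s + (length ?c + length ?d)"
    "s + length ?c + length ?d - 1 < s + (length ?c + length ?d)"
    using bcomp_nonempty[of s e] by linarith+
  with BXor show ?case
    by (simp add: Let_def ports_ok_append ports_ok_single add.assoc)
qed (auto simp: ports_ok_single)

text \<open>A condition on finished wire values instead of an evaluation, so that it applies to a
  template placed anywhere inside a larger circuit.\<close>

definition satisfies :: "bit list \<Rightarrow> (nat \<Rightarrow> nat) \<Rightarrow> nat \<Rightarrow> tgate list \<Rightarrow> bool" where
  "satisfies vs b s c \<longleftrightarrow> (\<forall>i<length c. vs ! (b 4 + s + i) = gate_val vs (inst b (c ! i)))"

lemma satisfies_append:
  "satisfies vs b s (c @ d) \<longleftrightarrow> satisfies vs b s c \<and> satisfies vs b (s + length c) d"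
  unfolding satisfies_def by (simp add: all_less_add nth_append add.assoc)

lemma satisfies_single: "satisfies vs b s [g] \<longleftrightarrow> vs ! (b 4 + s) = gate_val vs (inst b g)"
  by (simp add: satisfies_def)

lemma bcomp_val:
  "satisfies vs b s (bcomp s e) \<Longrightarrow>
   vs ! (b 4 + (s + length (bcomp s e) - 1)) = beval (\<lambda>p. vs ! wire b p) e"
proof (induction e arbitrary: s)
  case (BAnd e f)
  let ?c = "bcomp s e" and ?d = "bcomp (s + length (bcomp s e)) f"
  have "satisfies vs b s ?c" "satisfies vs b (s + length ?c) ?d"
    and "vs ! (b 4 + (s + length ?c + length ?d)) =
      vs ! (b 4 + (s + length ?c - 1)) * vs ! (b 4 + (s + length ?c + length ?d - 1))"
    using BAnd.prems by (simp_all add: Let_def satisfies_append satisfies_single wire_def add.assoc)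
  with BAnd.IH(1)[of s] BAnd.IH(2)[of "s + length ?c"] show ?case
    by (simp add: Let_def wire_def add.assoc)
next
  case (BXor e f)
  let ?c = "bcomp s e" and ?d = "bcomp (s + length (bcomp s e)) f"
  have "satisfies vs b s ?c" "satisfies vs b (s + length ?c) ?d"
    and "vs ! (b 4 + (s + length ?c + length ?d)) =
      vs ! (b 4 + (s + length ?c - 1)) + vs ! (b 4 + (s + length ?c + length ?d - 1))"
    using BXor.prems by (simp_all add: Let_def satisfies_append satisfies_single wire_def add.assoc)
  with BXor.IH(1)[of s] BXor.IH(2)[of "s + length ?c"] show ?case
    by (simp add: Let_def wire_def add.assoc)
qed (auto simp: satisfies_single wire_def)

text \<open>One template computes all the expressions. Their codes differ in length, so
  \<open>ps\<close> records where the values end up.\<close>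

lemma bcomp_list:
  assumes "\<forall>e\<in>set es. bvars e \<subseteq> X"
  shows "\<exists>c ps. length ps = length es \<and> set ps \<subseteq> {..<length c} \<and> ports_ok X 0 c \<and>
    (\<forall>vs b. satisfies vs b 0 c \<longrightarrow>
      (\<forall>i<length es. vs ! (b 4 + ps ! i) = beval (\<lambda>p. vs ! wire b p) (es ! i)))"
  using assms
proof (induction es rule: rev_induct)
  case Nil
  show ?case by (intro exI[of _ "[]"]) (simp add: ports_ok_def)
next
  case (snoc e es)
  then obtain c ps where c: "length ps = length es" "set ps \<subseteq> {..<length c}" "ports_ok X 0 c"
    and val: "\<And>vs b i. satisfies vs b 0 c \<Longrightarrow> i < length es \<Longrightarrow>
        vs ! (b 4 + ps ! i) = beval (\<lambda>p. vs ! wire b p) (es ! i)"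
    by auto
  let ?d = "bcomp (length c) e"
  have "satisfies vs b 0 (c @ ?d) \<longrightarrow>
      (\<forall>i<length (es @ [e]). vs ! (b 4 + (ps @ [length c + length ?d - 1]) ! i) =
         beval (\<lambda>p. vs ! wire b p) ((es @ [e]) ! i))" for vs b
    using val[of vs b] bcomp_val[of vs b "length c" e] c(1)
    by (auto simp: satisfies_append nth_append less_Suc_eq)
  moreover have "ports_ok X 0 (c @ ?d)"
    using c snoc.prems by (auto simp: ports_ok_append intro: ports_ok_bcomp)
  ultimately show ?case
    using c bcomp_nonempty[of "length c" e]
    by (intro exI[of _ "c @ ?d"] exI[of _ "ps @ [length c + length ?d - 1]"]) auto
qed

section \<open>One-hot codes and gadgets for finite functions\<close>

definition onehot :: "nat \<Rightarrow> bit list \<Rightarrow> nat \<Rightarrow> nat \<Rightarrow> bool" where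
  "onehot K vs a k \<longleftrightarrow> (\<forall>i<K. vs ! (a + i) = of_bool (i = k))"

text \<open>The basis has no constant 0; the empty sum is \<open>1 + 1\<close>.\<close>

definition bsum :: "bexp list \<Rightarrow> bexp" where
  "bsum es = foldr BXor es (BXor BOne BOne)"

lemma beval_bsum: "beval \<rho> (bsum es) = sum_list (map (beval \<rho>) es)"
  unfolding bsum_def by (induction es) simp_all

lemma bvars_bsum: "bvars (bsum es) = \<Union> (bvars ` set es)"
  unfolding bsum_def by (induction es) simp_all

lemma sum_list_of_bool_eq:
  "distinct xs \<Longrightarrow> sum_list (map (\<lambda>x. of_bool (x = y)) xs) = (of_bool (y \<in> set xs) :: 'a :: semiring_1)"
  by (induction xs) auto

text \<open>Output \<open>i\<close> is the sum, over all quadruples that \<open>\<phi>\<close> sends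
  to \<open>i\<close>, of the product of the four wires of the quadruple. On one-hot inputs only the
  product of the actual quadruple is 1, so the sum acts as a disjunction.\<close>

lemma gadget_exists:
  fixes \<phi> :: "nat \<Rightarrow> nat \<Rightarrow> nat \<Rightarrow> nat \<Rightarrow> nat"
  shows "\<exists>c. K \<le> length c \<and> ports_ok ({..<4} \<times> {..<K}) 0 c \<and>
    (\<forall>vs b k0 k1 k2 k3. satisfies vs b 0 c \<longrightarrow>
       k0 < K \<longrightarrow> k1 < K \<longrightarrow> k2 < K \<longrightarrow> k3 < K \<longrightarrow>
       onehot K vs (b 0) k0 \<longrightarrow> onehot K vs (b 1) k1 \<longrightarrow>
       onehot K vs (b 2) k2 \<longrightarrow> onehot K vs (b 3) k3 \<longrightarrow>
       onehot K vs (b 4 + (length c - K)) (\<phi> k0 k1 k2 k3))"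
proof -
  let ?X = "{..<4} \<times> {..<K} :: port set"
  let ?u = "[0..<K]"
  define ts where "ts i = filter (\<lambda>(a, b, c, d). \<phi> a b c d = i)
    (List.product ?u (List.product ?u (List.product ?u ?u)))" for i
  define ex where "ex = (\<lambda>(a, b, c, d).
    BAnd (BAnd (BVar (0, a)) (BVar (1, b))) (BAnd (BVar (2, c)) (BVar (3, d))))"
  define es where "es = map (\<lambda>i. bsum (map ex (ts i))) ?u"
  have "\<forall>e\<in>set es. bvars e \<subseteq> ?X"
    by (auto simp: es_def bvars_bsum ex_def ts_def)
  then obtain c ps where c: "length ps = K" "set ps \<subseteq> {..<length c}" "ports_ok ?X 0 c"
    and val: "\<And>vs b i. satisfies vs b 0 c \<Longrightarrow> i < K \<Longrightarrow>
        vs ! (b 4 + ps ! i) = beval (\<lambda>p. vs ! wire b p) (es ! i)"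
    using bcomp_list[of es ?X] by (auto simp: es_def)
  \<comment> \<open>The computed values are scattered over the template; copying them puts the
    output code on the last \<open>K\<close> wires, in order.\<close>
  let ?cp = "map (\<lambda>q. TAnd (4, q) (4, q)) ps"
  have "ports_ok ?X (length c) ?cp"
    using c(2) by (auto simp: ports_ok_def) (meson lessThan_iff nth_mem subset_iff trans_less_add1)+
  with c have "ports_ok ?X 0 (c @ ?cp)" by (simp add: ports_ok_append)
  moreover have "onehot K vs (b 4 + (length (c @ ?cp) - K)) (\<phi> k0 k1 k2 k3)"
    if r: "satisfies vs b 0 (c @ ?cp)" and k: "k0 < K" "k1 < K" "k2 < K" "k3 < K"
      and oh: "onehot K vs (b 0) k0" "onehot K vs (b 1) k1" "onehot K vs (b 2) k2"
        "onehot K vs (b 3) k3"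
    for vs b k0 k1 k2 k3
    unfolding onehot_def
  proof (intro allI impI)
    fix i assume i: "i < K"
    from r i have "vs ! (b 4 + length c + i) = gate_val vs (inst b (?cp ! i))"
      unfolding satisfies_append by (auto simp: satisfies_def c(1))
    also have "\<dots> = vs ! (b 4 + ps ! i)"
      using i c(1) by (cases "vs ! (b 4 + ps ! i)") (simp_all add: wire_def)
    also have "\<dots> = beval (\<lambda>p. vs ! wire b p) (es ! i)"
      using r i val by (simp add: satisfies_append)
    also have "\<dots> = sum_list (map (\<lambda>t. beval (\<lambda>p. vs ! wire b p) (ex t)) (ts i))"
      using i by (simp add: es_def beval_bsum comp_def)
    also have "\<dots> = sum_list (map (\<lambda>t. of_bool (t = (k0, k1, k2, k3))) (ts i))"
      by (rule arg_cong[of _ _ sum_list], rule map_cong[OF refl])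
        (use oh in \<open>auto simp: ts_def ex_def onehot_def wire_def\<close>)
    also have "\<dots> = of_bool ((k0, k1, k2, k3) \<in> set (ts i))"
      by (rule sum_list_of_bool_eq) (simp add: ts_def distinct_product)
    also have "\<dots> = of_bool (i = \<phi> k0 k1 k2 k3)"
      using k by (auto simp: ts_def)
    finally show "vs ! (b 4 + (length (c @ ?cp) - K) + i) = of_bool (i = \<phi> k0 k1 k2 k3)"
      using c(1) by simp
  qed
  ultimately show ?thesis
    using c(1) by (intro exI[of _ "c @ ?cp"]) auto
qed


section \<open>Machines as cellular automata\<close>

text \<open>A cell bundles the scanned contents of all tapes at the same distance from their heads,
  together with the state, the sign of its absolute position on tape 1 and a flag marking
  the head cell. State \<open>nstates M\<close> is an additional start state in which only the head of
  tape 0 moves right; in the halting state the head of tape 1 walks back to cell 0.\<close>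

type_synonym cell = "nat \<times> sym list \<times> int \<times> bool"

definition view :: "otm \<Rightarrow> config \<Rightarrow> int \<Rightarrow> cell" where
  "view M c i = (state c, map (\<lambda>k. tape c k (head c k + i)) [0..<ntapes M],
     sgn (head c 1 + i), i = 0)"

text \<open>State 2 passes to state 4, the answer no: verifiers run with the empty oracle.\<close>

definition nq :: "otm \<Rightarrow> nat \<Rightarrow> sym list \<Rightarrow> nat" where
  "nq M q w = (if q = nstates M then 0 else if q = 1 then 1 else if q = 2 then 4
     else next_state M q w)"

definition nw :: "otm \<Rightarrow> nat \<Rightarrow> sym list \<Rightarrow> nat \<Rightarrow> sym" where
  "nw M q w k = (if q = nstates M \<or> q = 1 \<or> q = 2 then w ! k else write_sym M q w k)"

definition nd :: "otm \<Rightarrow> nat \<Rightarrow> sym list \<Rightarrow> int \<Rightarrow> nat \<Rightarrow> int" where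
  "nd M q w g k = (if q = nstates M then of_bool (k = 0)
     else if q = 1 then (if k = 1 then - g else 0)
     else if q = 2 then 0 else dir_offset (move_dir M q w k))"

definition rstep :: "otm \<Rightarrow> config \<Rightarrow> config" where
  "rstep M c = (let q = state c; w = scanned M c; g = sgn (head c 1) in
     \<lparr> state = nq M q w,
       tape = (\<lambda>k. if k < ntapes M then (tape c k)(head c k := nw M q w k) else tape c k),
       head = (\<lambda>k. if k < ntapes M then head c k + nd M q w g k else head c k) \<rparr>)"

text \<open>When the head of tape \<open>k\<close> moves by \<open>d\<close>, relative position
  \<open>i\<close> shows what was at \<open>i + d\<close>, and the newly written symbol if that was
  the head cell. \<open>pick\<close> fetches this neighbour for each tape. The flag is taken from
  \<open>m\<close>, because the center itself does not move.\<close>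

definition local_map :: "otm \<Rightarrow> cell \<Rightarrow> cell \<Rightarrow> cell \<Rightarrow> cell \<Rightarrow> cell" where
  "local_map M l m r z = (case z of (q, w, g, _) \<Rightarrow>
     let pick = (\<lambda>k. if nd M q w g k = -1 then l else if nd M q w g k = 0 then m else r) in
     (nq M q w,
      map (\<lambda>k. if snd (snd (snd (pick k))) then nw M q w k else fst (snd (pick k)) ! k)
        [0..<ntapes M],
      fst (snd (snd (pick 1))), snd (snd (snd m))))"

lemma nd_range: "g \<in> {-1, 0, 1} \<Longrightarrow> nd M q w g k \<in> {-1, 0, 1}"
  by (cases "move_dir M q w k") (auto simp: nd_def)

lemma sgn_int_range: "sgn (i :: int) \<in> {-1, 0, 1}"
  by (auto simp: sgn_if)

lemma view_rstep:
  assumes "2 \<le> ntapes M"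
  shows "view M (rstep M c) i =
    local_map M (view M c (i - 1)) (view M c i) (view M c (i + 1)) (view M c 0)"
proof -
  let ?q = "state c" and ?w = "scanned M c" and ?g = "sgn (head c 1)"
  let ?d = "nd M ?q ?w ?g"
  define pick where "pick k = (if ?d k = -1 then view M c (i - 1)
    else if ?d k = 0 then view M c i else view M c (i + 1))" for k
  have pick: "pick k = view M c (i + ?d k)" for k
    using nd_range[OF sgn_int_range[of "head c 1"], of M ?q ?w k]
    by (auto simp: pick_def)
  have z: "view M c 0 = (?q, ?w, ?g, True)"
    by (simp add: view_def scanned_def)
  have "local_map M (view M c (i - 1)) (view M c i) (view M c (i + 1)) (view M c 0) =
     (nq M ?q ?w,
      map (\<lambda>k. if snd (snd (snd (pick k))) then nw M ?q ?w k else fst (snd (pick k)) ! k)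
        [0..<ntapes M],
      fst (snd (snd (pick 1))), snd (snd (snd (view M c i))))"
    unfolding local_map_def z by (simp add: pick_def[abs_def])
  also have "\<dots> = view M (rstep M c) i"
    using assms unfolding pick
    by (auto simp: view_def rstep_def Let_def ac_simps)
  finally show ?thesis ..
qed

text \<open>With the head of tape 0 at -1 the whole input lies strictly to the right of the center.
  Every input cell then has sign 1 and no head flag, and the first symbol needs no separate
  treatment.\<close>

definition start :: "otm \<Rightarrow> bool list \<Rightarrow> config" where
  "start M x = (init_config x)\<lparr>state := nstates M, head := (\<lambda>_. 0)(0 := -1)\<rparr>"

lemma rstep_start:
  assumes "wf_otm M" shows "rstep M (start M x) = init_config x"
  using assms
  by (auto simp: rstep_def start_def nq_def nw_def nd_def init_config_def Let_def wf_otm_def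
      scanned_def fun_eq_iff)

section \<open>Comparing the modified run with the original one\<close>

lemma rstep_eq_step:
  assumes "state c \<noteq> 1" "state c \<noteq> nstates M"
  shows "rstep M c = step M {} c"
proof (cases "state c = 2")
  case True
  have "(tape c k)(head c k := scanned M c ! k) = tape c k" if "k < ntapes M" for k
    using that by (simp add: scanned_def)
  with True assms show ?thesis
    by (cases c) (auto simp: rstep_def step_def Let_def nq_def nw_def nd_def fun_eq_iff scanned_def)
next
  case False
  with assms show ?thesis
    by (auto simp: rstep_def step_def Let_def nq_def nw_def nd_def)
qed

lemma rstep_halt:
  assumes "state c = 1" "wf_otm M"
  shows "rstep M c = c\<lparr>head := (head c)(1 := head c 1 - sgn (head c 1))\<rparr>"
  using assms by (cases c)
    (auto simp: rstep_def Let_def nq_def nw_def nd_def fun_eq_iff scanned_def wf_otm_def)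

text \<open>Walking back to cell 0 brings the first output symbol under the head of tape 1, so that
  acceptance is visible in the central cell.\<close>

lemma rsteps_halt:
  assumes "state c = 1" "wf_otm M"
  shows "state ((rstep M ^^ t) c) = 1 \<and> tape ((rstep M ^^ t) c) = tape c \<and>
    \<bar>head ((rstep M ^^ t) c) 1\<bar> = max 0 (\<bar>head c 1\<bar> - int t)"
proof (induction t)
  case (Suc t)
  then show ?case using rstep_halt[of "(rstep M ^^ t) c", OF _ assms(2)]
    by (auto simp: sgn_if)
qed (use assms in auto)

lemma step_state_lt:
  assumes "wf_otm M" "state c < nstates M"
  shows "state (step M A c) < nstates M"
  using assms by (auto simp: step_def Let_def wf_otm_def scanned_def)

lemma steps_state_lt:
  assumes "wf_otm M"
  shows "state ((step M A ^^ t) (init_config x)) < nstates M"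
  using assms by (induction t) (auto intro: step_state_lt simp: init_config_def wf_otm_def)

lemma step_halted: "state c = 1 \<Longrightarrow> (step M A ^^ t) c = c"
  by (induction t) (auto simp: step_def)

lemma step_head: "\<bar>head (step M A c) k\<bar> \<le> \<bar>head c k\<bar> + 1"
  by (cases "move_dir M (state c) (scanned M c) k") (auto simp: step_def Let_def)

lemma steps_head: "\<bar>head ((step M A ^^ t) (init_config x)) k\<bar> \<le> int t"
proof (induction t)
  case (Suc t)
  then show ?case using step_head[of M A "(step M A ^^ t) (init_config x)" k] by simp
qed (simp add: init_config_def)

lemma tape_word_singleton:
  assumes "tape_word t = [b]" shows "t 0 = Some b"
proof -
  let ?n = "LEAST n. t (int n) = None"
  have "?n = 1" using arg_cong[OF assms, of length] by (simp add: tape_word_def)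
  then have "t (int 0) \<noteq> None" using not_less_Least[of 0 "\<lambda>n. t (int n) = None"] by simp
  moreover have "the (t (int 0)) = b"
    using assms \<open>?n = 1\<close> by (simp add: tape_word_def)
  ultimately show ?thesis by auto
qed

text \<open>One step leaves the start state. If the machine halts after \<open>t0 \<le> T\<close>
  steps, its output head is at distance at most \<open>t0\<close> from cell 0, and the remaining
  \<open>2 * T - t0 \<ge> t0\<close> steps bring it back.\<close>

lemma rsteps_output:
  assumes wf: "wf_otm M" and comp: "computes_within M {} x T [b]"
  shows "fst (snd (view M ((rstep M ^^ (2 * T + 1)) (start M x)) 0)) ! 1 = Some b"
proof -
  let ?i = "init_config x"
  let ?h = "\<lambda>t. state ((step M {} ^^ t) ?i) = 1"
  \<comment> \<open>After halting, \<open>step\<close> is idle while \<open>rstep\<close> still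
    moves a head, so the runs are compared only up to the first halting time.\<close>
  define t0 where "t0 = (LEAST t. ?h t)"
  have hT: "?h T" and out: "tape_word (tape ((step M {} ^^ T) ?i) 1) = [b]"
    using comp by (auto simp: computes_within_def Let_def)
  have h0: "?h t0" and le: "t0 \<le> T" unfolding t0_def using hT by (auto intro: LeastI Least_le)
  have run: "(rstep M ^^ t) ?i = (step M {} ^^ t) ?i" if "t \<le> t0" for t
    using that
  proof (induction t)
    case (Suc t)
    then have "\<not> ?h t" unfolding t0_def using not_less_Least[of t ?h] by auto
    then have "rstep M ((step M {} ^^ t) ?i) = step M {} ((step M {} ^^ t) ?i)"
      by (intro rstep_eq_step) (use steps_state_lt[OF wf, where A = "{}" and t = t and x = x] in auto)
    with Suc show ?case by simp
  qed simp
  let ?c = "(step M {} ^^ t0) ?i"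
  have cT: "(step M {} ^^ T) ?i = ?c"
    using step_halted[OF h0, where M = M and A = "{}" and t = "T - t0"] le
    by (metis comp_apply funpow_add le_add_diff_inverse2)
  let ?d = "(rstep M ^^ (2 * T - t0)) ?c"
  have "(rstep M ^^ (2 * T + 1)) (start M x) = (rstep M ^^ (2 * T)) ?i"
    using rstep_start[OF wf, of x] by (simp add: funpow_swap1)
  also have "\<dots> = ?d"
    using run[of t0] le by (metis comp_apply funpow_add le_add_diff_inverse2 le_refl
      mult_2 trans_le_add1)
  finally have d: "(rstep M ^^ (2 * T + 1)) (start M x) = ?d" .
  have "\<bar>head ?c 1\<bar> \<le> int t0" by (rule steps_head)
  with rsteps_halt[OF h0 wf, of "2 * T - t0"] le
  have "head ?d 1 = 0" "tape ?d = tape ?c" by auto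
  then have "tape ?d 1 (head ?d 1) = Some b"
    using tape_word_singleton[OF out] cT by simp
  then show ?thesis unfolding d using wf by (simp add: view_def wf_otm_def)
qed

section \<open>The finite alphabet of cells\<close>

definition cells :: "otm \<Rightarrow> cell set" where
  "cells M = {..nstates M} \<times> {w. set w \<subseteq> UNIV \<and> length w = ntapes M} \<times> {-1, 0, 1} \<times> UNIV"

lemma finite_cells: "finite (cells M)"
  unfolding cells_def by (intro finite_cartesian_product finite_lists_length_eq) auto

lemma view_in_cells: "state c \<le> nstates M \<Longrightarrow> view M c i \<in> cells M"
  using sgn_int_range[of "head c 1 + i"] by (auto simp: view_def cells_def)

lemma rstep_state_le:
  assumes "wf_otm M" "state c \<le> nstates M" shows "state (rstep M c) \<le> nstates M"
proof -
  have "next_state M (state c) (scanned M c) < nstates M" if "state c < nstates M"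
    using that assms(1) by (auto simp: wf_otm_def scanned_def)
  then show ?thesis using assms by (auto simp: rstep_def Let_def nq_def wf_otm_def)
qed

lemma rsteps_in_cells:
  assumes "wf_otm M" shows "view M ((rstep M ^^ t) (start M x)) i \<in> cells M"
proof (rule view_in_cells)
  show "state ((rstep M ^^ t) (start M x)) \<le> nstates M"
    by (induction t) (auto intro: rstep_state_le[OF assms] simp: start_def)
qed


section \<open>The tableau circuit\<close>

lemma length_concat_uniform:
  "(\<And>b. b \<in> set bs \<Longrightarrow> length b = g) \<Longrightarrow> length (concat bs) = g * length bs"
  by (induction bs) auto

lemma nth_concat_uniform:
  assumes "\<And>b. b \<in> set bs \<Longrightarrow> length b = g" "k < length bs" "i < g"
  shows "concat bs ! (g * k + i) = bs ! k ! i"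
  using assms
proof (induction bs arbitrary: k)
  case (Cons b bs)
  then show ?case by (cases k) (auto simp: nth_append)
qed simp

lemma gate_ok_mono: "gate_ok k g \<Longrightarrow> k \<le> k' \<Longrightarrow> gate_ok k' g"
  by (cases g) auto

text \<open>All parameters depend on the machine only and not on its input. They are constants for
  the program that prints the circuit.\<close>

locale tableau =
  fixes M :: otm and K :: nat and code :: "cell \<Rightarrow> nat" and tg :: "tgate list"
  assumes wf_M: "wf_otm M"
    and code: "bij_betw code (cells M) {..<K}"
    and tg_length: "K \<le> length tg"
    and tg_ports: "ports_ok ({..<4} \<times> {..<K}) 0 tg"
    and tg_onehot: "\<And>vs b c0 c1 c2 c3. satisfies vs b 0 tg \<Longrightarrow>
      c0 \<in> cells M \<Longrightarrow> c1 \<in> cells M \<Longrightarrow> c2 \<in> cells M \<Longrightarrow> c3 \<in> cells M \<Longrightarrow>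
      onehot K vs (b 0) (code c0) \<Longrightarrow> onehot K vs (b 1) (code c1) \<Longrightarrow>
      onehot K vs (b 2) (code c2) \<Longrightarrow> onehot K vs (b 3) (code c3) \<Longrightarrow>
      onehot K vs (b 4 + (length tg - K)) (code (local_map M c0 c1 c2 c3))"
begin

definition G :: nat where "G = length tg"
definition Off :: nat where "Off = G - K"

definition cell0 :: "sym \<Rightarrow> int \<Rightarrow> bool \<Rightarrow> cell" where
  "cell0 s g h = (nstates M, map (\<lambda>k. if k = 0 then s else None) [0..<ntapes M], g, h)"

text \<open>The padding brings the block to the length of the gadget. A wire added to itself
  provides the constant 0.\<close>

definition constT :: "cell \<Rightarrow> tgate list" where
  "constT c = replicate Off TOne @
     map (\<lambda>i. if i = code c then TOne else TXor (0, 0) (0, 0)) [0..<K]"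

text \<open>Port \<open>(1, 0)\<close> will be an input bit of the witness and \<open>(2, 0)\<close>
  the first constant wire, so that adding it negates the bit. The code of the cell is thus one-hot
  for either value of the bit.\<close>

definition varT :: "tgate list" where
  "varT = replicate Off TOne @
     map (\<lambda>i. if i = code (cell0 (Some True) 1 False) then TAnd (1, 0) (1, 0)
              else if i = code (cell0 (Some False) 1 False) then TXor (1, 0) (2, 0)
              else TXor (0, 0) (0, 0)) [0..<K]"

text \<open>At most one code wire is 1, so a sum over the accepting codes serves as a disjunction.
  Ports \<open>(0, 0)\<close> and \<open>(1, 0)\<close> are the two extra inputs; base 3 is the
  center of the last row.\<close>

definition acc :: bexp where
  "acc = BAnd (BAnd (bsum (map (\<lambda>k. BVar (3, k))
       (filter (\<lambda>k. fst (snd (inv_into (cells M) code k)) ! 1 = Some True) [0..<K])))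
     (BVar (0, 0))) (BVar (1, 0))"

text \<open>The center, the \<open>2 * n + 1 + m\<close> cells of the encoded pair to its right, and
  a margin of \<open>R\<close> cells on either side, as information travels one cell per
  step.\<close>

definition width :: "nat \<Rightarrow> nat \<Rightarrow> nat \<Rightarrow> nat" where
  "width n m R = R + 1 + (2 * n + 1 + m) + R"

definition ibase :: "nat \<Rightarrow> nat \<Rightarrow> nat \<Rightarrow> nat" where
  "ibase m l j = (if j = 1 then l else if j = 2 then m + 2 else 0)"

text \<open>Block 0 consists of constants; block \<open>t W + i + 1\<close> is cell \<open>i\<close> of row \<open>t\<close>, with its one-hot
  code in the last \<open>K\<close> of its \<open>G\<close> wires. The bases of the gadget for cell \<open>i\<close> of row \<open>t + 1\<close> are
  its three neighbours, the center of row \<open>t\<close>, and the block itself.\<close>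

definition sbase :: "nat \<Rightarrow> nat \<Rightarrow> nat \<Rightarrow> nat \<Rightarrow> nat \<Rightarrow> nat \<Rightarrow> nat" where
  "sbase m R W t i j =
     (if j = 4 then m + 2 + G * (t * W + W + i + 1)
      else if j = 3 then m + 2 + Off + G * (t * W + R + 1)
      else m + 2 + Off + G * (t * W + i + j))"

definition tbase :: "nat \<Rightarrow> nat \<Rightarrow> nat \<Rightarrow> nat \<Rightarrow> nat" where
  "tbase m R W j =
     (if j = 0 then m else if j = 1 then m + 1
      else if j = 3 then m + 2 + Off + G * (R * W + R + 1)
      else m + 2 + G * (1 + W + R * W))"

definition constB :: "nat \<Rightarrow> cell \<Rightarrow> gate list" where
  "constB m c = map (inst (ibase m 0)) (constT c)"

definition varB :: "nat \<Rightarrow> nat \<Rightarrow> gate list" where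
  "varB m l = map (inst (ibase m l)) varT"

definition row0 :: "bool list \<Rightarrow> nat \<Rightarrow> nat \<Rightarrow> gate list list" where
  "row0 x m R =
     replicate R (constB m (cell0 None (-1) False)) @
     [constB m (cell0 None 0 True)] @
     concat (map (\<lambda>b. [constB m (cell0 (Some True) 1 False), constB m (cell0 (Some b) 1 False)]) x) @
     [constB m (cell0 (Some False) 1 False)] @
     map (varB m) [0..<m] @
     replicate R (constB m (cell0 None 1 False))"

definition stepB :: "nat \<Rightarrow> nat \<Rightarrow> nat \<Rightarrow> nat \<Rightarrow> nat \<Rightarrow> gate list" where
  "stepB m R W t i = map (inst (sbase m R W t i)) tg"

definition tail :: "nat \<Rightarrow> nat \<Rightarrow> nat \<Rightarrow> gate list" where
  "tail m R W = map (inst (tbase m R W)) (bcomp 0 acc)"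

definition tableau_gates :: "bool list \<Rightarrow> nat \<Rightarrow> nat \<Rightarrow> gate list" where
  "tableau_gates x m R = (let W = width (length x) m R in
     replicate G One @ concat (row0 x m R) @
     concat (map (\<lambda>t. concat (map (stepB m R W t) [0..<W])) [0..<R]) @ tail m R W)"

definition tableau_circuit :: "bool list \<Rightarrow> nat \<Rightarrow> nat \<Rightarrow> circuit" where
  "tableau_circuit x m R = (let W = width (length x) m R in
     \<lparr> inputs = m + 2, gates = tableau_gates x m R,
       out_wire = m + 1 + G * (1 + W + R * W) + length (bcomp 0 acc) \<rparr>)"

text \<open>A second view of the gate list, as blocks of equal length \<open>G\<close>: gate
  \<open>i\<close> of block \<open>\<beta>\<close> is gate \<open>G * \<beta> + i\<close> of the
  circuit.\<close>

definition blocks :: "bool list \<Rightarrow> nat \<Rightarrow> nat \<Rightarrow> gate list list" where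
  "blocks x m R = (let W = width (length x) m R in
     (replicate G One # row0 x m R) @ concat (map (\<lambda>t. map (stepB m R W t) [0..<W]) [0..<R]))"

section \<open>Addresses and well-formedness\<close>

lemma cell0_in_cells: "g \<in> {-1, 0, 1} \<Longrightarrow> cell0 s g h \<in> cells M"
  by (auto simp: cell0_def cells_def)

lemma code_lt: "c \<in> cells M \<Longrightarrow> code c < K"
  using code by (auto simp: bij_betw_def)

lemma code_eq_iff: "c \<in> cells M \<Longrightarrow> d \<in> cells M \<Longrightarrow> code c = code d \<longleftrightarrow> c = d"
  using code by (auto simp: bij_betw_def inj_on_def)

lemma G_Off: "Off + K = G" "0 < G"
  using tg_length code_lt[OF cell0_in_cells[of 0 None True]] by (auto simp: G_def Off_def)

lemma length_constB [simp]: "length (constB m c) = G"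
  using G_Off by (simp add: constB_def constT_def)

lemma length_varB [simp]: "length (varB m l) = G"
  using G_Off by (simp add: varB_def varT_def)

lemma length_stepB [simp]: "length (stepB m R W t i) = G"
  by (simp add: stepB_def G_def)

lemma length_row0: "length (row0 x m R) = width (length x) m R"
  by (simp add: row0_def width_def length_concat comp_def sum_list_triv)

lemma length_row0_block: "b \<in> set (row0 x m R) \<Longrightarrow> length b = G"
  by (auto simp: row0_def split: if_splits)

lemma length_block: "b \<in> set (blocks x m R) \<Longrightarrow> length b = G"
  by (auto simp: blocks_def Let_def dest: length_row0_block)

lemma length_blocks:
  "length (blocks x m R) = 1 + width (length x) m R + R * width (length x) m R"
  by (simp add: blocks_def Let_def length_row0 length_concat comp_def sum_list_triv)

lemma tableau_gates_blocks:
  "tableau_gates x m R = concat (blocks x m R) @ tail m R (width (length x) m R)"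
proof -
  have "concat (map (\<lambda>t. concat (map (f t) [0..<W])) ts) =
      concat (concat (map (\<lambda>t. map (f t) [0..<W]) ts))" for f :: "nat \<Rightarrow> nat \<Rightarrow> gate list" and W ts
    by (induction ts) auto
  then show ?thesis by (simp add: tableau_gates_def blocks_def Let_def)
qed

lemma blocks_0: "blocks x m R ! 0 = replicate G One"
  by (simp add: blocks_def Let_def)

lemma blocks_row0:
  "i < width (length x) m R \<Longrightarrow> blocks x m R ! Suc i = row0 x m R ! i"
  by (simp add: blocks_def Let_def nth_append length_row0)

lemma blocks_step:
  fixes x m R defines "W \<equiv> width (length x) m R"
  assumes "t < R" "i < W"
  shows "blocks x m R ! (t * W + W + i + 1) = stepB m R W t i"
proof -
  have "concat (map (\<lambda>t. map (stepB m R W t) [0..<W]) [0..<R]) ! (W * t + i) = stepB m R W t i"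
    using assms by (subst nth_concat_uniform) auto
  then show ?thesis
    by (simp add: blocks_def Let_def nth_append length_row0 W_def[symmetric] mult.commute)
qed

text \<open>Row 0 reads only the \<open>m + 2\<close> inputs and wire \<open>m + 2\<close>, the
  first gate of the constant block.\<close>

lemma row0_gate_ok: "b \<in> set (row0 x m R) \<Longrightarrow> g \<in> set b \<Longrightarrow> gate_ok (m + 3) g"
  by (auto simp: row0_def constB_def varB_def constT_def varT_def gate_ok_inst wire_def ibase_def
      split: if_splits)

lemma block_index:
  fixes x m R defines "W \<equiv> width (length x) m R"
  assumes "\<beta> < length (blocks x m R)"
  obtains "\<beta> = 0" | i where "i < W" "\<beta> = Suc i"
    | t i where "t < R" "i < W" "\<beta> = t * W + W + i + 1"
proof -
  have len: "\<beta> < 1 + W + R * W" using assms by (simp add: length_blocks)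
  have W: "0 < W" by (simp add: W_def width_def)
  consider "\<beta> = 0" | "0 < \<beta>" "\<beta> < 1 + W" | "1 + W \<le> \<beta>" by linarith
  then show thesis
  proof cases
    case 2
    then show thesis using that(2)[of "\<beta> - 1"] by simp
  next
    case 3
    define \<gamma> where "\<gamma> = \<beta> - (1 + W)"
    have "\<gamma> < R * W" using len 3 by (simp add: \<gamma>_def)
    then have "\<gamma> div W < R" using W by (simp add: less_mult_imp_div_less)
    moreover have "\<beta> = \<gamma> div W * W + W + \<gamma> mod W + 1"
      using 3 by (simp add: \<gamma>_def)
    ultimately show thesis using that(3)[of "\<gamma> div W" "\<gamma> mod W"] W by simp
  qed (use that in auto)
qed

text \<open>The bases point into strictly earlier blocks, even at the borders, because
  \<open>W\<close> is at least 2 and the central column \<open>R\<close> is below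
  \<open>W\<close>.\<close>

lemma sbase_lt:
  assumes "W = width n m R" "j < 4" "k < K"
  shows "sbase m R W t i j + k < sbase m R W t i 4"
proof -
  have less: "Off + G * a + k < G * b" if "a < b" for a b
  proof -
    have "Off + k + G * a < G * (a + 1)" using assms(3) G_Off by simp
    also have "\<dots> \<le> G * b" using that by (intro mult_le_mono2) simp
    finally show ?thesis by simp
  qed
  show ?thesis
  proof (cases "j = 3")
    case True
    then show ?thesis using less[of "t * W + R + 1" "t * W + W + i + 1"] assms(1)
      by (simp add: sbase_def width_def)
  next
    case False
    then show ?thesis using less[of "t * W + i + j" "t * W + W + i + 1"] assms
      by (simp add: sbase_def width_def)
  qed
qed

lemma stepB_gate_ok:
  assumes "W = width n m R" "k < G"
  shows "gate_ok (sbase m R W t i 4 + k) (stepB m R W t i ! k)"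
proof -
  have "wire (sbase m R W t i) p < sbase m R W t i 4 + k" if "p \<in> ports (tg ! k)" for p
  proof -
    have "p \<in> {..<4} \<times> {..<K} \<union> {4} \<times> {..<k}"
      using that tg_ports assms(2) unfolding ports_ok_def G_def by fastforce
    then show ?thesis
      using sbase_lt[OF assms(1), of "fst p" "snd p" t i]
      by (cases p) (auto simp: wire_def)
  qed
  then show ?thesis using assms(2) by (simp add: stepB_def gate_ok_inst G_def)
qed

lemma acc_ports: "ports_ok ({(0, 0), (1, 0)} \<union> {3} \<times> {..<K}) 0 (bcomp 0 acc)"
  by (rule ports_ok_bcomp) (auto simp: acc_def bvars_bsum)

lemma tail_gate_ok:
  assumes "W = width n m R" "k < length (bcomp 0 acc)"
  shows "gate_ok (tbase m R W 4 + k) (tail m R W ! k)"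
proof -
  have "wire (tbase m R W) p < tbase m R W 4 + k" if "p \<in> ports (bcomp 0 acc ! k)" for p
  proof -
    have "p \<in> {(0, 0), (1, 0)} \<union> {3} \<times> {..<K} \<union> {4} \<times> {..<k}"
      using that acc_ports assms(2) unfolding ports_ok_def by fastforce
    moreover have "Off + G * (R * W + R + 1) + l < G * (1 + W + R * W)" if "l < K" for l
    proof -
      have "Off + l + G * (R * W + R + 1) < G * (R * W + R + 2)" using that G_Off by simp
      also have "\<dots> \<le> G * (1 + W + R * W)"
        using assms(1) by (intro mult_le_mono2) (simp add: width_def)
      finally show ?thesis by simp
    qed
    ultimately show ?thesis
      by (cases p) (auto simp: wire_def tbase_def intro!: trans_less_add1)
  qed
  then show ?thesis using assms(2) by (simp add: tail_def gate_ok_inst)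
qed

lemma length_tableau_gates:
  "length (tableau_gates x m R) =
     G * (1 + width (length x) m R + R * width (length x) m R) + length (bcomp 0 acc)"
  by (simp add: tableau_gates_blocks length_concat_uniform[OF length_block] length_blocks tail_def)

lemma nth_gates_block:
  "\<beta> < length (blocks x m R) \<Longrightarrow> i < G \<Longrightarrow>
   tableau_gates x m R ! (G * \<beta> + i) = blocks x m R ! \<beta> ! i"
proof -
  assume b: "\<beta> < length (blocks x m R)" and i: "i < G"
  have "G * \<beta> + i < G * Suc \<beta>" using i by simp
  also have "\<dots> \<le> G * length (blocks x m R)" using b by (intro mult_le_mono2) simp
  finally show ?thesis using b i
    by (simp add: tableau_gates_blocks nth_append length_concat_uniform[OF length_block]
        nth_concat_uniform[OF length_block])
qed

lemma nth_gates_tail: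
  fixes x m R defines "W \<equiv> width (length x) m R"
  shows "tableau_gates x m R ! (G * (1 + W + R * W) + k) = tail m R W ! k"
  by (simp add: tableau_gates_blocks nth_append length_concat_uniform[OF length_block]
      length_blocks W_def)

lemma block_gate_ok:
  assumes b: "\<beta> < length (blocks x m R)" and o: "i < G"
  shows "gate_ok (m + 2 + (G * \<beta> + i)) (blocks x m R ! \<beta> ! i)"
  using b
proof (cases rule: block_index)
  case 1
  then show ?thesis using o by (simp add: blocks_0)
next
  case (2 j)
  then have "gate_ok (m + 3) (row0 x m R ! j ! i)"
    using o by (intro row0_gate_ok[of "row0 x m R ! j" x m R] nth_mem)
      (auto simp: length_row0 length_row0_block[OF nth_mem])
  then show ?thesis using 2 G_Off(2) by (auto simp: blocks_row0 elim!: gate_ok_mono)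
next
  case (3 t j)
  then show ?thesis
    using stepB_gate_ok[OF refl o, of m R "length x" t j]
    unfolding 3(3) blocks_step[OF 3(1,2)] by (simp add: sbase_def add.assoc)
qed

lemma tableau_gate_ok:
  assumes "k < length (tableau_gates x m R)"
  shows "gate_ok (m + 2 + k) (tableau_gates x m R ! k)"
proof (cases "k < G * length (blocks x m R)")
  case True
  then have "k div G < length (blocks x m R)" "k mod G < G"
    using G_Off(2) by (auto simp: less_mult_imp_div_less mult.commute)
  from block_gate_ok[OF this] nth_gates_block[OF this] show ?thesis by simp
next
  case False
  let ?W = "width (length x) m R"
  obtain l where l: "k = G * (1 + ?W + R * ?W) + l"
    using False length_blocks by (metis le_Suc_ex linorder_not_less)
  with assms have "l < length (bcomp 0 acc)" by (simp add: length_tableau_gates)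
  from tail_gate_ok[OF refl this, of m R "length x"] show ?thesis
    unfolding l nth_gates_tail by (simp add: tbase_def add.assoc)
qed

lemma wf_tableau_circuit: "wf_circuit (tableau_circuit x m R)"
  using tableau_gate_ok[of _ x m R] bcomp_nonempty[of 0 acc]
  by (simp add: wf_circuit_def tableau_circuit_def Let_def length_tableau_gates
      del: length_greater_0_conv)

section \<open>Correctness of the rows\<close>

definition encodes :: "bit list \<Rightarrow> gate list \<Rightarrow> cell \<Rightarrow> bool" where
  "encodes vs b c \<longleftrightarrow> (\<forall>i<K. gate_val vs (b ! (Off + i)) = of_bool (i = code c))"

lemma encodes_constB: "encodes vs (constB m c) c"
  by (auto simp: encodes_def constB_def constT_def nth_append)

lemma encodes_varB:
  assumes "vs ! l = of_bool b" "vs ! (m + 2) = 1"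
  shows "encodes vs (varB m l) (cell0 (Some b) 1 False)"
proof -
  have "cell0 (Some True) 1 False \<noteq> cell0 (Some False) 1 False"
    using wf_M by (auto simp: cell0_def wf_otm_def)
  then have "code (cell0 (Some True) 1 False) \<noteq> code (cell0 (Some False) 1 False)"
    by (simp add: code_eq_iff cell0_in_cells)
  then show ?thesis using assms
    by (cases b) (auto simp: encodes_def varB_def varT_def nth_append ibase_def wire_def)
qed

lemma view_start:
  "view M (start M w) (int i - int R) =
    (replicate R (cell0 None (-1) False) @ [cell0 None 0 True] @
     map (\<lambda>b. cell0 (Some b) 1 False) w @ replicate R (cell0 None 1 False)) ! i"
  if "i < R + 1 + length w + R"
proof -
  let ?p = "int i - int R"
  \<comment> \<open>The word appears shifted by one because the head of tape 0 starts at -1.\<close>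
  have *: "view M (start M w) ?p = cell0 (word_tape w (?p - 1)) (sgn ?p) (?p = 0)"
    using wf_M by (auto simp: view_def start_def init_config_def cell0_def wf_otm_def)
  consider "i < R" | "i = R" | "R < i" "i < R + 1 + length w" | "R + 1 + length w \<le> i"
    by linarith
  then show ?thesis
  proof cases
    case 3
    define k where "k = i - (R + 1)"
    have "i = R + 1 + k" "k < length w" using 3 by (auto simp: k_def)
    then show ?thesis unfolding * by (simp add: nth_append word_tape_def)
  next
    case 4
    then obtain k where "i = R + 1 + length w + k" by (metis le_Suc_ex)
    then show ?thesis using that unfolding * by (simp add: nth_append word_tape_def)
  next
    case 1
    then show ?thesis unfolding * by (simp add: nth_append word_tape_def)
  next
    case 2
    then show ?thesis unfolding * by (simp add: nth_append word_tape_def)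
  qed
qed

lemma row0_encodes:
  assumes y: "length y = m" and vy: "\<And>l. l < m \<Longrightarrow> vs ! l = of_bool (y ! l)"
    and one: "vs ! (m + 2) = 1" and i: "i < width (length x) m R"
  shows "encodes vs (row0 x m R ! i) (view M (start M (enc_pair x y)) (int i - int R))"
proof -
  let ?bit = "\<lambda>b. cell0 (Some b) 1 False"
  let ?w = "enc_pair x y"
  have len: "length ?w = 2 * length x + 1 + m"
    by (simp add: enc_pair_def y length_concat comp_def sum_list_triv)
  have x: "list_all2 (encodes vs)
      (concat (map (\<lambda>b. [constB m (?bit True), constB m (?bit b)]) x))
      (map ?bit (concat (map (\<lambda>b. [True, b]) x)))"
    by (induction x) (simp_all add: encodes_constB)
  have v: "list_all2 (encodes vs) (map (varB m) [0..<m]) (map ?bit y)"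
    by (rule list_all2_all_nthI) (auto simp: y intro!: encodes_varB vy one)
  have "list_all2 (encodes vs) (row0 x m R)
    (replicate R (cell0 None (-1) False) @ [cell0 None 0 True] @
     map ?bit ?w @ replicate R (cell0 None 1 False))"
    unfolding row0_def enc_pair_def map_append append_assoc
    by (intro list_all2_appendI x v) (simp_all add: encodes_constB list_all2_conv_all_nth)
  from list_all2_nthD[OF this, of i] i show ?thesis
    using view_start[of i R ?w] len by (simp add: length_row0 width_def)
qed

text \<open>Rows are correct only inside the light cone of the center of the last row: the
  neighbours of a border cell are unrelated blocks of the same or an earlier row.\<close>

lemma tableau_rows:
  fixes x y R z1 z2 defines "m \<equiv> length y" and "vs \<equiv> wire_vals (tableau_gates x (length y) R)
      (map of_bool y @ [z1, z2])" and "W \<equiv> width (length x) (length y) R"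
  assumes "t \<le> R" "\<bar>p\<bar> \<le> int (R - t)"
  shows "onehot K vs (m + 2 + Off + G * (t * W + nat (int R + p) + 1))
    (code (view M ((rstep M ^^ t) (start M (enc_pair x y))) p))"
  using assms(4,5)
proof (induction t arbitrary: p)
  let ?inp = "map of_bool y @ [z1, z2]"
  let ?c = "\<lambda>t. (rstep M ^^ t) (start M (enc_pair x y))"
  have gate: "vs ! (m + 2 + k) = gate_val vs (tableau_gates x m R ! k)"
    if "k < length (tableau_gates x m R)" for k
    using that wire_vals_gate[of k "tableau_gates x m R" ?inp] tableau_gate_ok[of k x m R]
    by (simp add: vs_def m_def)
  have block: "vs ! (m + 2 + (G * \<beta> + i)) = gate_val vs (blocks x m R ! \<beta> ! i)"
    if "\<beta> < length (blocks x m R)" "i < G" for \<beta> i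
  proof -
    have "G * \<beta> + i < G * Suc \<beta>" using that by simp
    also have "\<dots> \<le> G * length (blocks x m R)" using that by (intro mult_le_mono2) simp
    finally show ?thesis
      using gate[of "G * \<beta> + i"] nth_gates_block[OF that]
      by (simp add: length_tableau_gates length_blocks)
  qed
  {
    case 0
    have "vs ! (m + 2) = 1"
      using block[of 0 0] G_Off(2) by (simp add: blocks_0 length_blocks)
    moreover have "vs ! l = of_bool (y ! l)" if "l < m" for l
      using that by (simp add: vs_def wire_vals_nth nth_append m_def)
    moreover have lt: "nat (int R + p) < W"
      using 0 by (simp add: W_def width_def)
    ultimately have "encodes vs (row0 x m R ! nat (int R + p))
        (view M (start M (enc_pair x y)) (int (nat (int R + p)) - int R))"
      by (intro row0_encodes) (simp_all add: m_def W_def)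
    moreover have "int (nat (int R + p)) - int R = p" using 0 by auto
    ultimately have enc: "encodes vs (row0 x m R ! nat (int R + p)) (view M (start M (enc_pair x y)) p)"
      by simp
    show ?case unfolding onehot_def
    proof (intro allI impI)
      fix i assume i: "i < K"
      have "vs ! (m + 2 + (G * Suc (nat (int R + p)) + (Off + i))) =
          gate_val vs (row0 x m R ! nat (int R + p) ! (Off + i))"
        using block[of "Suc (nat (int R + p))" "Off + i"] lt i G_Off(1)
        by (simp add: length_blocks W_def[folded m_def] blocks_row0)
      then show "vs ! (m + 2 + Off + G * (0 * W + nat (int R + p) + 1) + i) =
          of_bool (i = code (view M (?c 0) p))"
        using enc i by (simp add: encodes_def ac_simps)
    qed
  next
    case (Suc t)
    let ?i = "nat (int R + p)"
    let ?b = "sbase m R W t ?i"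
    have t: "t < R" and iW: "?i < W" using Suc.prems by (auto simp: W_def width_def)
    have Wm: "W = width (length x) m R" by (simp add: W_def m_def)
    have "t * W + W + ?i + 1 < length (blocks x m R)"
    proof -
      have "t * W + W + ?i < (t + 1) * W + W" using iW by simp
      also have "\<dots> \<le> R * W + W" using t by (intro add_mono mult_le_mono1) auto
      finally show ?thesis by (simp add: length_blocks Wm[symmetric])
    qed
    then have "satisfies vs ?b 0 tg"
      using block[of "t * W + W + ?i + 1"] blocks_step[of t R ?i x m] t iW
      by (simp add: satisfies_def G_def[symmetric] sbase_def stepB_def Wm[symmetric] add.assoc)
    moreover have "view M (?c t) q \<in> cells M" for q
      by (rule rsteps_in_cells[OF wf_M])
    moreover have "onehot K vs (?b 0) (code (view M (?c t) (p - 1)))"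
      "onehot K vs (?b 1) (code (view M (?c t) p))"
      "onehot K vs (?b 2) (code (view M (?c t) (p + 1)))"
      "onehot K vs (?b 3) (code (view M (?c t) 0))"
    proof -
      \<comment> \<open>The cone of the next row is narrower by one on each side. So
        \<open>p - 1\<close> and \<open>p + 1\<close> lie in the cone of row \<open>t\<close>, and
        their columns are not truncated by \<open>nat\<close>.\<close>
      have "nat (int R + (p - 1)) + 1 = ?i" "nat (int R + (p + 1)) = ?i + 1"
        using Suc.prems by auto
      then have *: "t * W + nat (int R + (p - 1)) + 1 = t * W + ?i + 0"
        "t * W + nat (int R + (p + 1)) + 1 = t * W + ?i + 2" by auto
      show "onehot K vs (?b 0) (code (view M (?c t) (p - 1)))"
        using Suc.IH[of "p - 1"] Suc.prems unfolding * by (simp add: sbase_def)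
      show "onehot K vs (?b 1) (code (view M (?c t) p))"
        using Suc.IH[of p] Suc.prems by (simp add: sbase_def)
      show "onehot K vs (?b 2) (code (view M (?c t) (p + 1)))"
        using Suc.IH[of "p + 1"] Suc.prems unfolding * by (simp add: sbase_def)
      show "onehot K vs (?b 3) (code (view M (?c t) 0))"
        using Suc.IH[of 0] Suc.prems by (simp add: sbase_def)
    qed
    ultimately have "onehot K vs (?b 4 + (length tg - K))
        (code (local_map M (view M (?c t) (p - 1)) (view M (?c t) p) (view M (?c t) (p + 1))
          (view M (?c t) 0)))"
      by (intro tg_onehot)
    moreover have "?b 4 + (length tg - K) = m + 2 + Off + G * (Suc t * W + ?i + 1)"
      by (simp add: sbase_def Off_def G_def[symmetric] algebra_simps)
    ultimately show ?case
      using view_rstep[of M "?c t" p] wf_M by (simp add: wf_otm_def)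
  }
qed

lemma tableau_circuit_fun:
  assumes T: "computes_within M {} (enc_pair x y) T [a]" and m: "length y = m" and R: "R = 2 * T + 1"
  shows "circuit_fun (tableau_circuit x m R) (map of_bool y @ [z1, z2]) = of_bool a * z1 * z2"
proof -
  let ?inp = "map of_bool y @ [z1, z2]"
  define W where "W = width (length x) m R"
  define vs where "vs = wire_vals (tableau_gates x m R) ?inp"
  let ?v = "view M ((rstep M ^^ R) (start M (enc_pair x y))) 0"
  let ?b = "tbase m R W"
  have gate: "vs ! (m + 2 + k) = gate_val vs (tableau_gates x m R ! k)"
    if "k < length (tableau_gates x m R)" for k
    using that wire_vals_gate[of k "tableau_gates x m R" ?inp] tableau_gate_ok[of k x m R]
    by (simp add: vs_def m)
  have "satisfies vs ?b 0 (bcomp 0 acc)"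
    unfolding satisfies_def
  proof (intro allI impI)
    fix k assume k: "k < length (bcomp 0 acc)"
    have "vs ! (m + 2 + (G * (1 + W + R * W) + k)) =
        gate_val vs (tableau_gates x m R ! (G * (1 + W + R * W) + k))"
      by (rule gate) (use k in \<open>simp add: length_tableau_gates W_def\<close>)
    then show "vs ! (?b 4 + 0 + k) = gate_val vs (inst ?b (bcomp 0 acc ! k))"
      using k unfolding W_def nth_gates_tail by (simp add: tail_def tbase_def add.assoc)
  qed
  from bcomp_val[OF this]
  have "vs ! (?b 4 + (length (bcomp 0 acc) - 1)) = beval (\<lambda>p. vs ! wire ?b p) acc" by simp
  moreover have "?b 4 + (length (bcomp 0 acc) - 1) = out_wire (tableau_circuit x m R)"
    using bcomp_nonempty[of 0 acc]
    by (simp add: tbase_def tableau_circuit_def Let_def W_def[symmetric] del: length_greater_0_conv)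
  ultimately have "circuit_fun (tableau_circuit x m R) ?inp = beval (\<lambda>p. vs ! wire ?b p) acc"
    by (simp add: circuit_fun_def vs_def tableau_circuit_def Let_def)
  also have "\<dots> = sum_list (map (\<lambda>k. vs ! wire ?b (3, k))
      (filter (\<lambda>k. fst (snd (inv_into (cells M) code k)) ! 1 = Some True) [0..<K])) * z1 * z2"
  proof -
    have "vs ! m = z1" "vs ! (m + 1) = z2"
      by (simp_all add: vs_def wire_vals_nth m nth_append)
    then show ?thesis by (simp add: acc_def beval_bsum wire_def tbase_def comp_def)
  qed
  \<comment> \<open>At \<open>t = R\<close> the cone has shrunk to the center, the only cell that is
    read.\<close>
  also have "map (\<lambda>k. vs ! wire ?b (3, k))
      (filter (\<lambda>k. fst (snd (inv_into (cells M) code k)) ! 1 = Some True) [0..<K]) =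
    map (\<lambda>k. of_bool (k = code ?v))
      (filter (\<lambda>k. fst (snd (inv_into (cells M) code k)) ! 1 = Some True) [0..<K])"
    using tableau_rows[of R R 0 x y z1 z2]
    by (auto simp: onehot_def wire_def tbase_def m W_def[symmetric] vs_def[symmetric])
  also have "sum_list \<dots> = of_bool (code ?v < K \<and> fst (snd (inv_into (cells M) code (code ?v))) ! 1 = Some True)"
    by (subst sum_list_of_bool_eq) auto
  also have "\<dots> = of_bool (fst (snd ?v) ! 1 = Some True)"
    using rsteps_in_cells[OF wf_M, of R "enc_pair x y" 0] code code_lt
    by (simp add: bij_betw_def inv_into_f_f)
  also have "\<dots> = of_bool a"
    using rsteps_output[OF wf_M T] unfolding R by simp
  finally show ?thesis .
qed

end

lemma tableau_exists:
  assumes "wf_otm M" shows "\<exists>K code tg. tableau M K code tg"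
proof -
  define K where "K = card (cells M)"
  obtain code where code: "bij_betw code (cells M) {..<K}"
    using ex_bij_betw_finite_nat[OF finite_cells[of M]] unfolding K_def atLeast0LessThan by blast
  let ?d = "inv_into (cells M) code"
  obtain tg where tg: "K \<le> length tg" "ports_ok ({..<4} \<times> {..<K}) 0 tg"
    and oh: "\<And>vs b k0 k1 k2 k3. satisfies vs b 0 tg \<Longrightarrow>
       k0 < K \<Longrightarrow> k1 < K \<Longrightarrow> k2 < K \<Longrightarrow> k3 < K \<Longrightarrow>
       onehot K vs (b 0) k0 \<Longrightarrow> onehot K vs (b 1) k1 \<Longrightarrow>
       onehot K vs (b 2) k2 \<Longrightarrow> onehot K vs (b 3) k3 \<Longrightarrow>
       onehot K vs (b 4 + (length tg - K)) (code (local_map M (?d k0) (?d k1) (?d k2) (?d k3)))"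
    \<comment> \<open>The gadget decodes four numbers, applies the local rule and encodes the
      result.\<close>
    using gadget_exists[of K "\<lambda>k0 k1 k2 k3. code (local_map M (?d k0) (?d k1) (?d k2) (?d k3))"]
    by blast
  have d: "?d (code c) = c" "code c < K" if "c \<in> cells M" for c
    using that code by (auto simp: bij_betw_def inv_into_f_f)
  have "tableau M K code tg"
  proof
    fix vs b c0 c1 c2 c3
    assume "satisfies vs b 0 tg" and c: "c0 \<in> cells M" "c1 \<in> cells M" "c2 \<in> cells M" "c3 \<in> cells M"
      and "onehot K vs (b 0) (code c0)" "onehot K vs (b 1) (code c1)"
        "onehot K vs (b 2) (code c2)" "onehot K vs (b 3) (code c3)"
    then show "onehot K vs (b 4 + (length tg - K)) (code (local_map M c0 c1 c2 c3))"
      using oh[of vs b "code c0" "code c1" "code c2" "code c3"] d by simp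
  qed (use assms code tg in auto)
  then show ?thesis by blast
qed


section \<open>Structured programs for oracle machines\<close>

type_synonym mem = "nat \<Rightarrow> (int \<Rightarrow> sym) \<times> int"

definition rd :: "mem \<Rightarrow> nat \<Rightarrow> sym" where
  "rd s k = fst (s k) (snd (s k))"

definition act :: "nat \<Rightarrow> (sym \<Rightarrow> sym \<times> dir) \<Rightarrow> mem \<Rightarrow> mem" where
  "act k f s = s(k := ((fst (s k))(snd (s k) := fst (f (rd s k))),
     snd (s k) + dir_offset (snd (f (rd s k)))))"

datatype com =
    Skip
  | Act nat "sym \<Rightarrow> sym \<times> dir"
  | Seq com com  (infixr ";;" 60)
  | Branch nat "sym \<Rightarrow> bool" com com
  | While nat "sym \<Rightarrow> bool" com
  | Query

text \<open>Tape 3 receives the answer of the oracle, since the states \<open>q_yes\<close> and \<open>q_no\<close> do not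
  remember where the query was asked.\<close>

inductive exec :: "bool list set \<Rightarrow> com \<Rightarrow> mem \<Rightarrow> nat \<Rightarrow> mem \<Rightarrow> bool" for A where
  Skip: "exec A Skip s 0 s"
| Act: "exec A (Act k f) s 1 (act k f s)"
| Seq: "exec A c s t s' \<Longrightarrow> exec A d s' u s'' \<Longrightarrow> exec A (c ;; d) s (t + u) s''"
| BranchT: "P (rd s k) \<Longrightarrow> exec A c s t s' \<Longrightarrow> exec A (Branch k P c d) s (t + 2) s'"
| BranchF: "\<not> P (rd s k) \<Longrightarrow> exec A d s t s' \<Longrightarrow> exec A (Branch k P c d) s (t + 1) s'"
| WhileF: "\<not> P (rd s k) \<Longrightarrow> exec A (While k P c) s 1 s"
| WhileT: "P (rd s k) \<Longrightarrow> exec A c s t s' \<Longrightarrow> exec A (While k P c) s' u s'' \<Longrightarrow>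
    exec A (While k P c) s (t + u + 2) s''"
| Query: "exec A Query s 3 (act 3 (\<lambda>_. (Some (tape_word (fst (s 2)) \<in> A), Stay)) s)"

section \<open>Compilation to a transition table\<close>

datatype ins = IAct nat "sym \<Rightarrow> sym \<times> dir" | IBr nat "sym \<Rightarrow> bool" nat nat | IQuery

text \<open>A conditional with two equal targets is the unconditional jump. The test and this jump
  are the two extra steps of \<open>BranchT\<close> and \<open>WhileT\<close>.\<close>

fun compile :: "nat \<Rightarrow> com \<Rightarrow> ins list" where
  "compile a Skip = []"
| "compile a (Act k f) = [IAct k f]"
| "compile a (c ;; d) = (let C = compile a c in C @ compile (a + length C) d)"
| "compile a (Branch k P c d) =
     (let C = compile (a + 1) c; D = compile (a + length C + 2) d;
          e = a + length C + 2 + length D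
      in IBr k P (a + 1) (a + length C + 2) # C @ IBr k P e e # D)"
| "compile a (While k P c) =
     (let C = compile (a + 1) c in IBr k P (a + 1) (a + length C + 2) # C @ [IBr k P a a])"
| "compile a Query = [IQuery]"

fun tapes :: "com \<Rightarrow> nat set" where
  "tapes Skip = {}"
| "tapes (Act k f) = {k}"
| "tapes (c ;; d) = tapes c \<union> tapes d"
| "tapes (Branch k P c d) = insert k (tapes c \<union> tapes d)"
| "tapes (While k P c) = insert k (tapes c)"
| "tapes Query = {}"

fun queries :: "com \<Rightarrow> nat" where
  "queries (c ;; d) = queries c + queries d"
| "queries (Branch k P c d) = queries c + queries d"
| "queries (While k P c) = queries c"
| "queries Query = 1"
| "queries _ = 0"

lemma finite_tapes: "finite (tapes c)"
  by (induction c) auto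

lemma queries_compile: "length (filter ((=) IQuery) (compile a c)) = queries c"
  by (induction c arbitrary: a) (auto simp: Let_def)

definition goto :: "ins list \<Rightarrow> nat \<Rightarrow> nat" where
  "goto P a = (if a \<le> length P then 5 + a else 1)"

text \<open>Instruction \<open>a\<close> becomes state \<open>5 + a\<close>, behind the reserved
  states, and state \<open>5 + length P\<close> leads to halting. State 0 writes the marks of the
  counters. The parameter \<open>r\<close> is the return address of the only query.\<close>

definition machine :: "ins list \<Rightarrow> nat \<Rightarrow> nat \<Rightarrow> otm" where
  "machine P K r =
    \<lparr> ntapes = K, nstates = 6 + length P,
      next_state = (\<lambda>q w.
        if q = 0 then 5
        else if q = 3 \<or> q = 4 then goto P r
        else if 5 \<le> q \<and> q < 5 + length P then
          (case P ! (q - 5) of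
             IAct k f \<Rightarrow> goto P (q - 4)
           | IBr k p a b \<Rightarrow> goto P (if p (w ! k) then a else b)
           | IQuery \<Rightarrow> 2)
        else 1),
      write_sym = (\<lambda>q w l.
        if q = 0 \<and> 4 \<le> l then Some True
        else if q = 3 \<and> l = 3 then Some True
        else if q = 4 \<and> l = 3 then Some False
        else if 5 \<le> q \<and> q < 5 + length P then
          (case P ! (q - 5) of IAct k f \<Rightarrow> if l = k then fst (f (w ! k)) else w ! l | _ \<Rightarrow> w ! l)
        else w ! l),
      move_dir = (\<lambda>q w l.
        if 5 \<le> q \<and> q < 5 + length P then
          (case P ! (q - 5) of IAct k f \<Rightarrow> if l = k then snd (f (w ! k)) else Stay | _ \<Rightarrow> Stay)
        else Stay) \<rparr>"

lemma wf_machine: "3 \<le> K \<Longrightarrow> wf_otm (machine P K r)"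
  by (auto simp: wf_otm_def machine_def goto_def split: ins.splits)

definition sim :: "nat \<Rightarrow> config \<Rightarrow> nat \<Rightarrow> mem \<Rightarrow> bool" where
  "sim K c pc s \<longleftrightarrow> state c = 5 + pc \<and> (\<forall>k<K. tape c k = fst (s k) \<and> head c k = snd (s k))"

definition code_at :: "ins list \<Rightarrow> nat \<Rightarrow> ins list \<Rightarrow> bool" where
  "code_at P a C \<longleftrightarrow> a + length C \<le> length P \<and> (\<forall>i<length C. P ! (a + i) = C ! i)"

lemma code_at_append: "code_at P a (C @ D) \<longleftrightarrow> code_at P a C \<and> code_at P (a + length C) D"
  unfolding code_at_def by (auto simp: all_less_add nth_append add.assoc)

lemma code_at_Cons:
  "code_at P a (i # C) \<longleftrightarrow> a < length P \<and> P ! a = i \<and> code_at P (Suc a) C"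
  unfolding code_at_def by (auto simp: All_less_Suc2)

lemma sim_scanned:
  assumes "sim K c pc s" "k < K"
  shows "scanned (machine P K r) c ! k = rd s k"
  using assms by (simp add: scanned_def machine_def sim_def rd_def)

lemma sim_act:
  assumes "sim K c pc s" "pc < length P" "P ! pc = IAct k f" "k < K"
  shows "sim K (step (machine P K r) A c) (Suc pc) (act k f s)"
proof -
  have sc: "map (\<lambda>k. tape c k (head c k)) [0..<K] ! l = rd s l" if "l < K" for l
    using sim_scanned[OF assms(1) that] by (simp add: scanned_def machine_def)
  show ?thesis using assms sc
    by (auto simp: sim_def step_def Let_def machine_def act_def rd_def goto_def scanned_def)
qed

lemma sim_branch:
  assumes "sim K c pc s" "pc < length P" "P ! pc = IBr k p a b" "k < K"
    "(if p (rd s k) then a else b) \<le> length P"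
  shows "sim K (step (machine P K r) A c) (if p (rd s k) then a else b) s"
proof -
  have sc: "map (\<lambda>k. tape c k (head c k)) [0..<K] ! l = rd s l" if "l < K" for l
    using sim_scanned[OF assms(1) that] by (simp add: scanned_def machine_def)
  show ?thesis using assms sc
    by (auto simp: sim_def step_def Let_def machine_def rd_def goto_def scanned_def)
qed

text \<open>The three steps enter \<open>q_query\<close>, receive the answer, and leave
  \<open>q_yes\<close> or \<open>q_no\<close> for the return address while writing the answer on
  tape 3.\<close>

lemma sim_query:
  assumes "sim K c pc s" "pc < length P" "P ! pc = IQuery" "4 \<le> K" "r = Suc pc"
  shows "sim K ((step (machine P K r) A ^^ 3) c) (Suc pc)
    (act 3 (\<lambda>_. (Some (tape_word (fst (s 2)) \<in> A), Stay)) s)"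
proof -
  let ?M = "machine P K r"
  define ans where "ans \<longleftrightarrow> tape_word (fst (s 2)) \<in> A"
  let ?same = "\<lambda>c. \<forall>k<K. tape c k = fst (s k) \<and> head c k = snd (s k)"
  define c1 where "c1 = step ?M A c"
  define c2 where "c2 = step ?M A c1"
  have 1: "state c1 = 2" "?same c1"
    using assms unfolding c1_def
    by (auto simp: sim_def step_def Let_def machine_def scanned_def)
  have 2: "state c2 = (if ans then 3 else 4)" "?same c2"
    using 1 assms(4) unfolding c2_def by (auto simp: step_def ans_def)
  have "sim K (step ?M A c2) (Suc pc) (act 3 (\<lambda>_. (Some ans, Stay)) s)"
    using 2 assms(2,4,5)
    by (auto simp: step_def sim_def Let_def machine_def scanned_def goto_def act_def)
  then show ?thesis by (simp add: numeral_3_eq_3 ans_def c1_def c2_def)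
qed

lemma exec_sim:
  assumes "exec A c s t s'" "tapes c \<subseteq> {..<K}" "4 \<le> K" "code_at P a (compile a c)"
    and "\<forall>i<length P. P ! i = IQuery \<longrightarrow> r = Suc i" "sim K cf a s"
  shows "sim K ((step (machine P K r) A ^^ t) cf) (a + length (compile a c)) s'"
  using assms
proof (induction arbitrary: a cf rule: exec.induct)
  case (Skip s)
  then show ?case by simp
next
  case (Act k f s)
  then show ?case by (simp add: sim_act code_at_Cons)
next
  case (Seq c s t s' d u s'')
  let ?st = "step (machine P K r) A"
  let ?C = "compile a c"
  have "sim K ((?st ^^ t) cf) (a + length ?C) s'"
    using Seq by (intro Seq.IH(1)) (auto simp: Let_def code_at_append)
  then have "sim K ((?st ^^ u) ((?st ^^ t) cf)) (a + length ?C + length (compile (a + length ?C) d)) s''"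
    using Seq by (intro Seq.IH(2)) (auto simp: Let_def code_at_append)
  then show ?case by (simp add: Let_def add.commute[of t] funpow_add add.assoc)
next
  case (BranchT p s k c t s' d)
  let ?st = "step (machine P K r) A"
  let ?C = "compile (a + 1) c"
  let ?D = "compile (a + length ?C + 2) d"
  let ?e = "a + length ?C + 2 + length ?D"
  have at: "a < length P" "P ! a = IBr k p (a + 1) (a + length ?C + 2)" "code_at P (a + 1) ?C"
    "a + 1 + length ?C < length P" "P ! (a + 1 + length ?C) = IBr k p ?e ?e" "?e \<le> length P"
    using BranchT.prems(3)
    by (auto simp: Let_def code_at_Cons code_at_append) (auto simp: code_at_def)
  have "sim K (?st cf) (a + 1) s"
    using sim_branch[OF BranchT.prems(5) at(1,2)] BranchT at by simp
  then have "sim K ((?st ^^ t) (?st cf)) (a + 1 + length ?C) s'"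
    using BranchT at by (intro BranchT.IH) auto
  from sim_branch[OF this at(4,5)] at(6) BranchT.prems
  have "sim K (?st ((?st ^^ t) (?st cf))) ?e s'" by simp
  then show ?case by (simp add: Let_def funpow_swap1 add.assoc)
next
  case (BranchF p s k d t s' c)
  let ?st = "step (machine P K r) A"
  let ?C = "compile (a + 1) c"
  let ?D = "compile (a + length ?C + 2) d"
  have at: "a < length P" "P ! a = IBr k p (a + 1) (a + length ?C + 2)"
    "code_at P (a + length ?C + 2) ?D" "a + length ?C + 2 \<le> length P"
    using BranchF.prems(3)
    by (auto simp: Let_def code_at_Cons code_at_append)
  have "sim K (?st cf) (a + length ?C + 2) s"
    using sim_branch[OF BranchF.prems(5) at(1,2)] BranchF at by simp
  then have "sim K ((?st ^^ t) (?st cf)) (a + length ?C + 2 + length ?D) s'"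
    using BranchF at by (intro BranchF.IH) auto
  then show ?case by (simp add: Let_def funpow_swap1 add.assoc)
next
  case (WhileF p s k c)
  let ?C = "compile (a + 1) c"
  have at: "a < length P" "P ! a = IBr k p (a + 1) (a + length ?C + 2)"
    "a + length ?C + 2 \<le> length P"
    using WhileF.prems(3)
    by (auto simp: Let_def code_at_Cons code_at_append) 
  from sim_branch[OF WhileF.prems(5) at(1,2)] WhileF at show ?case
    by (simp add: Let_def)
next
  case (WhileT p s k c t s' u s'')
  let ?st = "step (machine P K r) A"
  let ?C = "compile (a + 1) c"
  have at: "a < length P" "P ! a = IBr k p (a + 1) (a + length ?C + 2)" "code_at P (a + 1) ?C"
    "a + 1 + length ?C < length P" "P ! (a + 1 + length ?C) = IBr k p a a"
    using WhileT.prems(3)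
    by (auto simp: Let_def code_at_Cons code_at_append)
  have "sim K (?st cf) (a + 1) s"
    using sim_branch[OF WhileT.prems(5) at(1,2)] WhileT at by simp
  then have "sim K ((?st ^^ t) (?st cf)) (a + 1 + length ?C) s'"
    using WhileT at by (intro WhileT.IH(1)) auto
  from sim_branch[OF this at(4,5)] at(1) WhileT.prems
  have "sim K (?st ((?st ^^ t) (?st cf))) a s'" by simp
  then have "sim K ((?st ^^ u) (?st ((?st ^^ t) (?st cf)))) (a + length (compile a (While k p c))) s''"
    using WhileT.prems by (intro WhileT.IH(2)) auto
  moreover have "(?st ^^ u) (?st ((?st ^^ t) (?st cf))) = (?st ^^ (t + u + 2)) cf"
  proof -
    have "(?st ^^ (t + u + 2)) cf = (?st ^^ (u + Suc (Suc t))) cf" by (simp add: add.commute)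
    also have "\<dots> = (?st ^^ u) (?st ((?st ^^ t) (?st cf)))"
      by (simp only: funpow_add comp_apply funpow.simps(2)) (simp add: funpow_swap1)
    finally show ?thesis ..
  qed
  ultimately show ?case by simp
next
  case (Query s)
  then show ?case by (simp add: sim_query code_at_Cons del: funpow.simps)
qed

text \<open>Tapes from 4 on are counters: the head position is the value and a mark at cell 0
  makes zero recognizable.\<close>

definition ctr :: "nat \<Rightarrow> (int \<Rightarrow> sym) \<times> int" where
  "ctr v = ((\<lambda>i. if i = 0 then Some True else None), int v)"

definition init_mem :: "bool list \<Rightarrow> mem" where
  "init_mem x k = (if k = 0 then (word_tape x, 0) else if k < 4 then (\<lambda>_. None, 0) else ctr 0)"

text \<open>The two additional steps mark the counters before the program and halt after it; halting
  configurations are stationary, so any larger clock will do. The same machine serves every oracle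
  and input.\<close>

lemma com_machine:
  assumes "queries c = 1"
  shows "\<exists>M. wf_otm M \<and> (\<forall>A x t s' T. exec A c (init_mem x) t s' \<longrightarrow> t + 2 \<le> T \<longrightarrow>
    computes_within M A x T (tape_word (fst (s' 1))))"
proof -
  define P where "P = compile 0 c"
  have "card {i. i < length P \<and> IQuery = P ! i} = 1"
    using queries_compile[of 0 c] assms by (simp add: P_def length_filter_conv_card)
  then obtain i0 where "{i. i < length P \<and> IQuery = P ! i} = {i0}" by (rule card_1_singletonE)
  then have q: "\<forall>i<length P. P ! i = IQuery \<longrightarrow> Suc i0 = Suc i" by (metis (mono_tags, lifting) mem_Collect_eq singletonD)
  define K where "K = 4 + Max (insert 0 (tapes c)) + 1"
  have "k \<le> Max (insert 0 (tapes c))" if "k \<in> tapes c" for k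
    using that finite_tapes[of c] by (intro Max_ge) auto
  then have K: "tapes c \<subseteq> {..<K}" "4 \<le> K"
    by (fastforce simp: K_def)+
  define M where "M = machine P K (Suc i0)"
  have "computes_within M A x T (tape_word (fst (s' 1)))"
    if ex: "exec A c (init_mem x) t s'" and T: "t + 2 \<le> T" for A x t s' T
  proof -
    let ?st = "step M A"
    have "sim K (?st (init_config x)) 0 (init_mem x)"
      using K(2) by (auto simp: sim_def step_def init_config_def Let_def M_def machine_def scanned_def
          init_mem_def ctr_def fun_eq_iff)
    from exec_sim[OF ex K _ q this[unfolded M_def]]
    have "sim K ((?st ^^ t) (?st (init_config x))) (length P) s'"
      by (simp add: P_def[symmetric] code_at_def M_def)
    moreover define d where "d = (?st ^^ t) (?st (init_config x))"
    ultimately have d: "state d = 5 + length P" "\<forall>k<K. tape d k = fst (s' k) \<and> head d k = snd (s' k)"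
      by (auto simp: sim_def)
    have h: "state (?st d) = 1" "tape (?st d) 1 = tape d 1"
      using d K(2) by (auto simp: step_def Let_def M_def machine_def scanned_def)
    have "(?st ^^ T) (init_config x) = (?st ^^ (T - (t + 2))) ((?st ^^ (t + 2)) (init_config x))"
      using T by (metis comp_apply funpow_add le_add_diff_inverse2)
    also have "(?st ^^ (t + 2)) (init_config x) = ?st d"
      by (simp add: d_def funpow_swap1)
    finally have "(?st ^^ T) (init_config x) = ?st d"
      using step_halted[OF h(1)] by simp
    then show ?thesis using h d K(2) by (simp add: computes_within_def)
  qed
  moreover have "wf_otm M" using K(2) by (simp add: M_def wf_machine)
  ultimately show ?thesis by blast
qed


section \<open>Programs writing parametrized words\<close>

definition runs :: "bool list set \<Rightarrow> com \<Rightarrow> mem \<Rightarrow> nat \<Rightarrow> mem \<Rightarrow> bool" where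
  "runs A c s t s' \<longleftrightarrow> (\<exists>u\<le>t. exec A c s u s')"

lemma runs_weaken: "runs A c s t s' \<Longrightarrow> s' = s'' \<Longrightarrow> t \<le> t' \<Longrightarrow> runs A c s t' s''"
  unfolding runs_def by (meson le_trans)

lemma runs_Skip: "runs A Skip s 0 s"
  unfolding runs_def by (auto intro: exec.Skip)

lemma runs_Act: "runs A (Act k f) s 1 (act k f s)"
  unfolding runs_def by (meson exec.Act order_refl)

lemma runs_Seq: "runs A c s t s' \<Longrightarrow> runs A d s' u s'' \<Longrightarrow> runs A (c ;; d) s (t + u) s''"
  unfolding runs_def by (meson add_mono exec.Seq)

lemma runs_Branch:
  assumes "p (rd s k) \<Longrightarrow> runs A c s t s'" "\<not> p (rd s k) \<Longrightarrow> runs A d s t s'"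
  shows "runs A (Branch k p c d) s (t + 2) s'"
proof (cases "p (rd s k)")
  case True
  then show ?thesis using assms(1) unfolding runs_def by (meson add_le_mono1 exec.BranchT)
next
  case False
  then obtain u where "u \<le> t" "exec A d s u s'" using assms(2) unfolding runs_def by blast
  then show ?thesis using exec.BranchF[of p s k A d u s' c] False unfolding runs_def
    by (intro exI[of _ "u + 1"]) auto
qed

lemma runs_Query: "runs A Query s 3 (act 3 (\<lambda>_. (Some (tape_word (fst (s 2)) \<in> A), Stay)) s)"
  unfolding runs_def by (auto intro: exec.Query)

lemma runs_While:
  assumes "\<And>i. i < n \<Longrightarrow> p (rd (S i) k)" "\<not> p (rd (S n) k)"
    and "\<And>i. i < n \<Longrightarrow> runs A c (S i) t (S (Suc i))"
  shows "runs A (While k p c) (S 0) (n * (t + 2) + 1) (S n)"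
proof -
  \<comment> \<open>Induction on the number \<open>j\<close> of rounds still to be made.\<close>
  have "runs A (While k p c) (S (n - j)) (j * (t + 2) + 1) (S n)" if "j \<le> n" for j
    using that
  proof (induction j)
    case 0
    have "exec A (While k p c) (S n) 1 (S n)" using assms(2) by (rule exec.WhileF)
    then show ?case unfolding runs_def by auto
  next
    case (Suc j)
    let ?i = "n - Suc j"
    have i: "?i < n" "Suc ?i = n - j" using Suc.prems by auto
    obtain u where u: "u \<le> t" "exec A c (S ?i) u (S (n - j))"
      using assms(3)[OF i(1)] i(2) unfolding runs_def by auto
    obtain u' where u': "u' \<le> j * (t + 2) + 1" "exec A (While k p c) (S (n - j)) u' (S n)"
      using Suc unfolding runs_def by auto
    have "exec A (While k p c) (S ?i) (u + u' + 2) (S n)"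
      by (rule exec.WhileT[where P = p, OF assms(1)[OF i(1)] u(2) u'(2)])
    moreover have "u + u' + 2 \<le> Suc j * (t + 2) + 1" using u(1) u'(1) by simp
    ultimately show ?case unfolding runs_def by blast
  qed
  from this[of n] show ?thesis by simp
qed

section \<open>Elementary programs on counters and tapes\<close>

definition conc :: "bool list \<Rightarrow> nat \<Rightarrow> (nat \<Rightarrow> nat) \<Rightarrow> bool list \<Rightarrow> mem" where
  "conc x h v w k = (if k = 0 then (word_tape x, int h) else if k = 2 then (word_tape w, int (length w))
     else if k < 4 then (\<lambda>_. None, 0) else ctr (v (k - 4)))"

definition inc :: "nat \<Rightarrow> com" where "inc r = Act (4 + r) (\<lambda>y. (y, MoveR))"
definition dec :: "nat \<Rightarrow> com" where "dec r = Act (4 + r) (\<lambda>y. (y, MoveL))"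
definition move0 :: "dir \<Rightarrow> com" where "move0 d = Act 0 (\<lambda>y. (y, d))"
definition put :: "bool \<Rightarrow> com" where "put b = Act 2 (\<lambda>_. (Some b, MoveR))"
definition loop :: "nat \<Rightarrow> com \<Rightarrow> com" where "loop r c = While (4 + r) (\<lambda>y. y = None) c"

lemma runs_inc: "runs A (inc r) (conc x h v w) 1 (conc x h (v(r := Suc (v r))) w)"
  unfolding inc_def
  by (rule runs_weaken[OF runs_Act]) (auto simp: act_def conc_def ctr_def rd_def fun_eq_iff)

lemma runs_dec: "0 < v r \<Longrightarrow> runs A (dec r) (conc x h v w) 1 (conc x h (v(r := v r - 1)) w)"
  unfolding dec_def
  by (rule runs_weaken[OF runs_Act]) (auto simp: act_def conc_def ctr_def rd_def fun_eq_iff)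

lemma runs_right: "runs A (move0 MoveR) (conc x h v w) 1 (conc x (Suc h) v w)"
  unfolding move0_def
  by (rule runs_weaken[OF runs_Act]) (auto simp: act_def conc_def rd_def fun_eq_iff)

lemma runs_left: "0 < h \<Longrightarrow> runs A (move0 MoveL) (conc x h v w) 1 (conc x (h - 1) v w)"
  unfolding move0_def
  by (rule runs_weaken[OF runs_Act]) (auto simp: act_def conc_def rd_def fun_eq_iff)

lemma word_tape_snoc: "(word_tape w)(int (length w) := Some b) = word_tape (w @ [b])"
  by (auto simp: word_tape_def fun_eq_iff nth_append nat_less_iff)

lemma runs_put: "runs A (put b) (conc x h v w) 1 (conc x h v (w @ [b]))"
  unfolding put_def
  by (rule runs_weaken[OF runs_Act])
    (auto simp: act_def conc_def rd_def fun_eq_iff word_tape_snoc[symmetric])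

lemma rd_conc_ctr: "rd (conc x h v w) (4 + r) = (if v r = 0 then Some True else None)"
  by (simp add: rd_def conc_def ctr_def)

lemma rd_conc_0: "rd (conc x h v w) 0 = (if h < length x then Some (x ! h) else None)"
  by (simp add: rd_def conc_def word_tape_def)

lemma runs_loop:
  assumes "\<And>i. i < n \<Longrightarrow> v i r \<noteq> 0" "v n r = 0"
    and "\<And>i. i < n \<Longrightarrow>
      runs A c (conc x (h i) (v i) (w i)) t (conc x (h (Suc i)) (v (Suc i)) (w (Suc i)))"
  shows "runs A (loop r c) (conc x (h 0) (v 0) (w 0)) (n * (t + 2) + 1) (conc x (h n) (v n) (w n))"
  unfolding loop_def
  by (rule runs_While[where S = "\<lambda>i. conc x (h i) (v i) (w i)"])
    (use assms in \<open>auto simp: rd_conc_ctr\<close>)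

section \<open>Arithmetic on counters\<close>

datatype aexp = Cst nat | Var nat | Plus aexp aexp | Times aexp aexp

fun aval :: "aexp \<Rightarrow> (nat \<Rightarrow> nat) \<Rightarrow> nat" where
  "aval (Cst k) v = k"
| "aval (Var j) v = v j"
| "aval (Plus a b) v = aval a v + aval b v"
| "aval (Times a b) v = aval a v * aval b v"

fun avars :: "aexp \<Rightarrow> nat set" where
  "avars (Cst k) = {}"
| "avars (Var j) = {j}"
| "avars (Plus a b) = avars a \<union> avars b"
| "avars (Times a b) = avars a \<union> avars b"

text \<open>Counters from \<open>d\<close> on are scratch space, zero before and after. Reading a
  counter destroys it, so a variable is drained into both \<open>r\<close> and \<open>d\<close> and
  then restored from \<open>d\<close>. A product first puts one factor into \<open>d\<close> and
  uses it to count the additions of the other.\<close>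

fun addto :: "nat \<Rightarrow> aexp \<Rightarrow> nat \<Rightarrow> com" where
  "addto d (Cst k) r = ((\<lambda>c. inc r ;; c) ^^ k) Skip"
| "addto d (Var j) r = loop j (dec j ;; inc r ;; inc d) ;; loop d (dec d ;; inc j)"
| "addto d (Plus a b) r = addto d a r ;; addto d b r"
| "addto d (Times a b) r = addto (d + 1) a d ;; loop d (dec d ;; addto (d + 1) b r)"

lemma aval_cong: "(\<And>k. k \<in> avars a \<Longrightarrow> v k = v' k) \<Longrightarrow> aval a v = aval a v'"
  by (induction a) auto

lemma aval_bound: "\<exists>p :: nat poly. \<forall>v B. (\<forall>k\<in>avars a. v k \<le> B) \<longrightarrow> aval a v \<le> poly p B"
proof (induction a)
  case (Cst k)
  show ?case by (intro exI[of _ "[:k:]"]) simp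
next
  case (Var j)
  show ?case by (intro exI[of _ "[:0, 1:]"]) simp
next
  case (Plus a b)
  then obtain p q :: "nat poly" where "\<forall>v B. (\<forall>k\<in>avars a. v k \<le> B) \<longrightarrow> aval a v \<le> poly p B"
    "\<forall>v B. (\<forall>k\<in>avars b. v k \<le> B) \<longrightarrow> aval b v \<le> poly q B" by blast
  then show ?case by (intro exI[of _ "p + q"]) (auto intro: add_mono)
next
  case (Times a b)
  then obtain p q :: "nat poly" where "\<forall>v B. (\<forall>k\<in>avars a. v k \<le> B) \<longrightarrow> aval a v \<le> poly p B"
    "\<forall>v B. (\<forall>k\<in>avars b. v k \<le> B) \<longrightarrow> aval b v \<le> poly q B" by blast
  then show ?case by (intro exI[of _ "p * q"]) (auto intro: mult_mono)
qed

text \<open>A single polynomial serves all oracles, memories and choices of registers: only a bound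
  on the variables read enters the time.\<close>

definition adds_within :: "aexp \<Rightarrow> nat poly \<Rightarrow> bool" where
  "adds_within a p \<longleftrightarrow> (\<forall>A x h v w d r B. avars a \<subseteq> {..<r} \<longrightarrow> r < d \<longrightarrow> (\<forall>k\<ge>d. v k = 0) \<longrightarrow>
     (\<forall>k\<in>avars a. v k \<le> B) \<longrightarrow>
     runs A (addto d a r) (conc x h v w) (poly p B) (conc x h (v(r := v r + aval a v)) w))"

lemma adds_withinD:
  assumes "adds_within a p" "avars a \<subseteq> {..<r}" "r < d" "\<forall>k\<ge>d. v k = 0" "\<forall>k\<in>avars a. v k \<le> B"
  shows "runs A (addto d a r) (conc x h v w) (poly p B) (conc x h (v(r := v r + aval a v)) w)"
  using assms unfolding adds_within_def by blast

lemma addto_runs: "\<exists>p. adds_within a p"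
proof (induction a)
  case (Cst k)
  have "runs A (((\<lambda>c. inc r ;; c) ^^ k) Skip) (conc x h v w) k (conc x h (v(r := v r + k)) w)"
    for A x h v w r
  proof (induction k arbitrary: v)
    case 0
    then show ?case by (simp add: runs_Skip)
  next
    case (Suc k)
    have "runs A (inc r ;; ((\<lambda>c. inc r ;; c) ^^ k) Skip) (conc x h v w) (Suc k)
        (conc x h (v(r := v r + Suc k)) w)"
      by (rule runs_weaken[OF runs_Seq[OF runs_inc Suc.IH]])
        (auto intro!: arg_cong[of _ _ "\<lambda>v. conc x h v w"])
    then show ?case by (simp add: fun_upd_def)
  qed
  then show ?case by (intro exI[of _ "[:k:]"]) (simp add: adds_within_def)
next
  case (Var j)
  have "runs A (addto d (Var j) r) (conc x h v w) (2 + 9 * v j) (conc x h (v(r := v r + v j)) w)"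
    if "j < r" "r < d" "\<forall>k\<ge>d. v k = 0" for A x h v w d r
  proof -
    have ne: "j \<noteq> r" "j \<noteq> d" "r \<noteq> d" "v d = 0" using that by auto
    let ?v = "\<lambda>i. v(j := v j - i, r := v r + i, d := i)"
    let ?u = "\<lambda>i. v(r := v r + v j, j := i, d := v j - i)"
    have "runs A (loop j (dec j ;; inc r ;; inc d)) (conc x h (?v 0) w) (v j * (3 + 2) + 1)
        (conc x h (?v (v j)) w)"
    proof (rule runs_loop[where v = ?v and h = "\<lambda>_. h" and w = "\<lambda>_. w"])
      fix i assume "i < v j"
      then show "runs A (dec j ;; inc r ;; inc d) (conc x h (?v i) w) 3 (conc x h (?v (Suc i)) w)"
        using ne
        by (intro runs_weaken[OF runs_Seq[OF runs_dec runs_Seq[OF runs_inc runs_inc]]])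
          (auto intro!: arg_cong[of _ _ "\<lambda>v. conc x h v w"])
    qed (use ne in auto)
    moreover have "?v 0 = v" using ne by auto
    moreover have "?v (v j) = ?u 0" using ne by auto
    moreover have "runs A (loop d (dec d ;; inc j)) (conc x h (?u 0) w) (v j * (2 + 2) + 1)
        (conc x h (?u (v j)) w)"
    proof (rule runs_loop[where v = ?u and h = "\<lambda>_. h" and w = "\<lambda>_. w"])
      fix i assume "i < v j"
      then show "runs A (dec d ;; inc j) (conc x h (?u i) w) 2 (conc x h (?u (Suc i)) w)"
        using ne
        by (intro runs_weaken[OF runs_Seq[OF runs_dec runs_inc]])
          (auto intro!: arg_cong[of _ _ "\<lambda>v. conc x h v w"])
    qed (use ne in auto)
    moreover have "?u (v j) = v(r := v r + v j)" using ne by auto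
    ultimately have "runs A (loop j (dec j ;; inc r ;; inc d) ;; loop d (dec d ;; inc j)) (conc x h v w)
        (v j * (3 + 2) + 1 + (v j * (2 + 2) + 1)) (conc x h (v(r := v r + v j)) w)"
      using runs_Seq by metis
    then show ?thesis by (auto elim!: runs_weaken)
  qed
  from runs_weaken[OF this] have "adds_within (Var j) [:2, 9:]"
    unfolding adds_within_def by simp
  then show ?case ..
next
  case (Plus a b)
  then obtain p q where ind: "adds_within a p" "adds_within b q" by blast
  note p = adds_withinD[OF ind(1)] and q = adds_withinD[OF ind(2)]
  have "runs A (addto d (Plus a b) r) (conc x h v w) (poly (p + q) B)
      (conc x h (v(r := v r + aval (Plus a b) v)) w)"
    if "avars (Plus a b) \<subseteq> {..<r}" "r < d" "\<forall>k\<ge>d. v k = 0" "\<forall>k\<in>avars (Plus a b). v k \<le> B"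
    for A x h v w d r B
  proof -
    let ?v = "v(r := v r + aval a v)"
    have "runs A (addto d b r) (conc x h ?v w) (poly q B) (conc x h (?v(r := ?v r + aval b ?v)) w)"
      using that by (intro q) auto
    moreover have "aval b ?v = aval b v" using that(1) by (intro aval_cong) auto
    ultimately show ?thesis
      using runs_Seq[OF p[of r d v B A x h w]] that by (simp add: add.assoc)
  qed
  then show ?case unfolding adds_within_def by blast
next
  case (Times a b)
  then obtain p q where ind: "adds_within a p" "adds_within b q" by blast
  note p = adds_withinD[OF ind(1)] and q = adds_withinD[OF ind(2)]
  obtain s :: "nat poly" where s: "\<And>v B. \<forall>k\<in>avars a. v k \<le> B \<Longrightarrow> aval a v \<le> poly s B"
    using aval_bound[of a] by blast
  have "runs A (addto d (Times a b) r) (conc x h v w) (poly (p + s * (q + [:3:]) + 1) B)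
      (conc x h (v(r := v r + aval (Times a b) v)) w)"
    if "avars (Times a b) \<subseteq> {..<r}" "r < d" "\<forall>k\<ge>d. v k = 0" "\<forall>k\<in>avars (Times a b). v k \<le> B"
    for A x h v w d r B
  proof -
    let ?n = "aval a v"
    let ?v = "\<lambda>i. v(d := ?n - i, r := v r + i * aval b v)"
    have 1: "runs A (addto (d + 1) a d) (conc x h v w) (poly p B) (conc x h (?v 0) w)"
    proof -
      have "avars a \<subseteq> {..<d}" "v d = 0" "?v 0 = v(d := v d + ?n)" using that by auto
      then show ?thesis using p[of d "d + 1" v B A x h w] that by auto
    qed
    have 2: "runs A (loop d (dec d ;; addto (d + 1) b r)) (conc x h (?v 0) w)
      (?n * (1 + poly q B + 2) + 1) (conc x h (?v ?n) w)"
    proof (rule runs_loop[where v = ?v and h = "\<lambda>_. h" and w = "\<lambda>_. w"])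
      fix i assume i: "i < ?n"
      let ?u = "(?v i)(d := ?v i d - 1)"
      have "runs A (addto (d + 1) b r) (conc x h ?u w) (poly q B) (conc x h (?u(r := ?u r + aval b ?u)) w)"
        using that by (intro q) auto
      moreover have "aval b ?u = aval b v" using that(1,2) by (intro aval_cong) auto
      moreover have "?u(r := ?u r + aval b v) = ?v (Suc i)" using that(2) by auto
      ultimately have "runs A (addto (d + 1) b r) (conc x h ?u w) (poly q B) (conc x h (?v (Suc i)) w)"
        by simp
      then show "runs A (dec d ;; addto (d + 1) b r) (conc x h (?v i) w) (1 + poly q B)
          (conc x h (?v (Suc i)) w)"
        using i that(2) by (intro runs_Seq[OF runs_dec]) auto
    qed (use that in auto)
    have "?v ?n = v(r := v r + aval (Times a b) v)" using that by auto
    moreover have "?n * (1 + poly q B + 2) \<le> poly s B * (poly q B + 3)"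
      using s[of v B] that(4) by (intro mult_mono) auto
    ultimately show ?thesis
      using runs_Seq[OF 1 2] by (auto elim!: runs_weaken simp del: fun_upd_apply)
  qed
  then show ?case unfolding adds_within_def by blast
qed

section \<open>A loop language for printing words\<close>

datatype emit = ESkip | Bit bool | Cat emit emit | Loop nat aexp emit | IfIn nat nat emit emit

text \<open>\<open>Loop j a e\<close> binds the variable \<open>j\<close>; \<open>t\<close> in \<open>IfIn j t e f\<close> is a scratch register.\<close>

fun em :: "emit \<Rightarrow> bool list \<Rightarrow> (nat \<Rightarrow> nat) \<Rightarrow> bool list" where
  "em ESkip x v = []"
| "em (Bit b) x v = [b]"
| "em (Cat e f) x v = em e x v @ em f x v"
| "em (Loop j a e) x v = concat (map (\<lambda>i. em e x (v(j := i))) [0..<aval a v])"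
| "em (IfIn j t e f) x v = (if v j < length x \<and> x ! v j then em e x v else em f x v)"

fun wf_emit :: "nat set \<Rightarrow> nat \<Rightarrow> emit \<Rightarrow> bool" where
  "wf_emit X d ESkip \<longleftrightarrow> True"
| "wf_emit X d (Bit b) \<longleftrightarrow> True"
| "wf_emit X d (Cat e f) \<longleftrightarrow> wf_emit X d e \<and> wf_emit X d f"
| "wf_emit X d (Loop j a e) \<longleftrightarrow> d \<le> j \<and> avars a \<subseteq> X \<and> wf_emit (insert j X) (j + 2) e"
| "wf_emit X d (IfIn j t e f) \<longleftrightarrow> j \<in> X \<and> d \<le> t \<and> wf_emit X d e \<and> wf_emit X d f"

text \<open>\<open>Loop j\<close> keeps the index in counter \<open>j\<close> and the number of
  remaining rounds in \<open>j + 1\<close>, so its body works from \<open>j + 2\<close> on.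
  \<open>IfIn\<close> must test while the head stands on the symbol; hence the way back appears in
  both branches.\<close>

fun emitter :: "emit \<Rightarrow> com" where
  "emitter ESkip = Skip"
| "emitter (Bit b) = put b"
| "emitter (Cat e f) = emitter e ;; emitter f"
| "emitter (Loop j a e) = addto (j + 2) a (j + 1) ;;
     loop (j + 1) (dec (j + 1) ;; emitter e ;; inc j) ;; loop j (dec j)"
| "emitter (IfIn j t e f) = loop j (dec j ;; inc t ;; move0 MoveR) ;;
     Branch 0 (\<lambda>y. y = Some True)
       (loop t (dec t ;; inc j ;; move0 MoveL) ;; emitter e)
       (loop t (dec t ;; inc j ;; move0 MoveL) ;; emitter f)"

lemma queries_addto [simp]: "queries (addto d a r) = 0"
proof (induction a arbitrary: d r)
  case (Cst k)
  show ?case by (induction k) (auto simp: inc_def)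
qed (auto simp: loop_def inc_def dec_def)

lemma queries_emitter [simp]: "queries (emitter e) = 0"
  by (induction e) (auto simp: put_def loop_def inc_def dec_def move0_def)

lemma em_cong: "wf_emit X d e \<Longrightarrow> (\<And>k. k \<in> X \<Longrightarrow> v k = v' k) \<Longrightarrow> em e x v = em e x v'"
proof (induction e arbitrary: X d v v')
  case (Loop j a e)
  have "aval a v = aval a v'" using Loop.prems by (intro aval_cong) auto
  moreover have "em e x (v(j := i)) = em e x (v'(j := i))" for i
    using Loop.prems by (intro Loop.IH[of "insert j X" "j + 2"]) auto
  ultimately show ?case by simp
next
  case (Cat e f)
  from Cat.prems show ?case
    using Cat.IH(1)[of X d v v'] Cat.IH(2)[of X d v v'] by simp
next
  case (IfIn j t e f)
  from IfIn.prems show ?case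
    using IfIn.IH(1)[of X d v v'] IfIn.IH(2)[of X d v v'] by simp
qed auto

definition emits_within :: "emit \<Rightarrow> nat poly \<Rightarrow> bool" where
  "emits_within e p \<longleftrightarrow> (\<forall>A x v w X d B. X \<subseteq> {..<d} \<longrightarrow> wf_emit X d e \<longrightarrow> (\<forall>k\<ge>d. v k = 0) \<longrightarrow>
     (\<forall>k\<in>X. v k \<le> B) \<longrightarrow>
     runs A (emitter e) (conc x 0 v w) (poly p B) (conc x 0 v (w @ em e x v)))"

lemma emits_withinD:
  assumes "emits_within e p" "X \<subseteq> {..<d}" "wf_emit X d e" "\<forall>k\<ge>d. v k = 0" "\<forall>k\<in>X. v k \<le> B"
  shows "runs A (emitter e) (conc x 0 v w) (poly p B) (conc x 0 v (w @ em e x v))"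
  using assms unfolding emits_within_def by blast

lemma emitter_runs: "\<exists>p. emits_within e p"
proof (induction e)
  case ESkip
  show ?case by (intro exI[of _ 0]) (simp add: runs_Skip emits_within_def)
next
  case (Bit b)
  show ?case by (intro exI[of _ 1]) (use runs_put in \<open>simp add: emits_within_def\<close>)
next
  case (Cat e f)
  then obtain p q where ind: "emits_within e p" "emits_within f q" by blast
  note p = emits_withinD[OF ind(1)] and q = emits_withinD[OF ind(2)]
  have "runs A (emitter (Cat e f)) (conc x 0 v w) (poly (p + q) B) (conc x 0 v (w @ em (Cat e f) x v))"
    if "X \<subseteq> {..<d}" "wf_emit X d (Cat e f)" "\<forall>k\<ge>d. v k = 0" "\<forall>k\<in>X. v k \<le> B" for A x v w X d B
    using runs_Seq[OF p[of X d v B A x w] q[of X d v B A x "w @ em e x v"]] that by simp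
  then show ?case unfolding emits_within_def by blast
next
  case (Loop j a e)
  then obtain p where ind: "emits_within e p" by blast
  obtain q where add: "adds_within a q" using addto_runs by blast
  note p = emits_withinD[OF ind] and q = adds_withinD[OF add]
  obtain s :: "nat poly" where s: "\<And>v B. \<forall>k\<in>avars a. v k \<le> B \<Longrightarrow> aval a v \<le> poly s B"
    using aval_bound[of a] by blast
  \<comment> \<open>Inside the body the index is one more variable. It is bounded by
    \<open>poly s B\<close>, so the time of the body is \<open>p\<close> taken at
    \<open>B + poly s B\<close>. The 4 pays for the two counter updates and the loop test with its
    jump.\<close>
  let ?p = "q + (s * (pcompose p ([:0, 1:] + s) + [:4:]) + 1) + (s * [:3:] + 1)"
  have "runs A (emitter (Loop j a e)) (conc x 0 v w) (poly ?p B) (conc x 0 v (w @ em (Loop j a e) x v))"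
    if X: "X \<subseteq> {..<d}" and wf: "wf_emit X d (Loop j a e)" and v: "\<forall>k\<ge>d. v k = 0"
      and B: "\<forall>k\<in>X. v k \<le> B" for A x v w X d B
  proof -
    let ?n = "aval a v"
    have d: "d \<le> j" "avars a \<subseteq> X" "wf_emit (insert j X) (j + 2) e" using wf by auto
    have v0: "v j = 0" "v (Suc j) = 0" using v d by auto
    have jX: "k < j" if "k \<in> X" for k using that X d by force
    have n: "?n \<le> poly s B" using s B d by blast
    let ?v = "\<lambda>i. v(j := i, Suc j := ?n - i)"
    let ?w = "\<lambda>i. w @ concat (map (\<lambda>i. em e x (v(j := i))) [0..<i])"
    let ?t = "poly p (B + poly s B) + 2"
    have "avars a \<subseteq> {..<j + 1}" using d jX by force
    then have 1: "runs A (addto (j + 2) a (j + 1)) (conc x 0 v w) (poly q B) (conc x 0 (?v 0) (?w 0))"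
      using q[of "j + 1" "j + 2" v B A x 0 w] B d v v0 by (auto simp: fun_upd_idem)
    have 2: "runs A (loop (j + 1) (dec (j + 1) ;; emitter e ;; inc j)) (conc x 0 (?v 0) (?w 0))
      (?n * (?t + 2) + 1) (conc x 0 (?v ?n) (?w ?n))"
    proof (rule runs_loop[where v = ?v and h = "\<lambda>_. 0" and w = ?w])
      fix i assume i: "i < ?n"
      let ?u = "v(j := i, Suc j := ?n - Suc i)"
      have "runs A (emitter e) (conc x 0 ?u (?w i)) (poly p (B + poly s B))
          (conc x 0 ?u (?w i @ em e x ?u))"
      proof (rule p[OF _ d(3)])
        show "insert j X \<subseteq> {..<j + 2}" using jX by force
        show "\<forall>k\<ge>j + 2. ?u k = 0" using v d by auto
        show "\<forall>k\<in>insert j X. ?u k \<le> B + poly s B" using B i n jX by (auto intro: trans_le_add1)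
      qed
      \<comment> \<open>Counter \<open>j + 1\<close> changes during the loop but is not a variable
        of the body.\<close>
      moreover have "em e x ?u = em e x (v(j := i))"
        by (rule em_cong[OF d(3)]) (use jX in force)
      ultimately have "runs A (emitter e) (conc x 0 ?u (?w i)) (poly p (B + poly s B))
          (conc x 0 ?u (?w (Suc i)))" by simp
      moreover have "runs A (dec (j + 1)) (conc x 0 (?v i) (?w i)) 1 (conc x 0 ?u (?w i))"
        by (rule runs_weaken[OF runs_dec]) (use i in \<open>auto intro!: arg_cong[of _ _ "\<lambda>v. conc x 0 v (?w i)"]\<close>)
      moreover have "runs A (inc j) (conc x 0 ?u (?w (Suc i))) 1 (conc x 0 (?v (Suc i)) (?w (Suc i)))"
        by (rule runs_weaken[OF runs_inc]) (simp_all add: fun_upd_twist[of "Suc j" j])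
      ultimately show "runs A (dec (j + 1) ;; emitter e ;; inc j) (conc x 0 (?v i) (?w i)) ?t
          (conc x 0 (?v (Suc i)) (?w (Suc i)))"
        by (intro runs_weaken[OF runs_Seq[OF _ runs_Seq]]) auto
    qed auto
    let ?u = "\<lambda>i. v(j := ?n - i)"
    have 3: "runs A (loop j (dec j)) (conc x 0 (?u 0) (?w ?n)) (?n * (1 + 2) + 1) (conc x 0 (?u ?n) (?w ?n))"
    proof (rule runs_loop[where v = ?u and h = "\<lambda>_. 0" and w = "\<lambda>_. ?w ?n"])
      fix i assume i: "i < ?n"
      then show "runs A (dec j) (conc x 0 (?u i) (?w ?n)) 1 (conc x 0 (?u (Suc i)) (?w ?n))"
        by (intro runs_weaken[OF runs_dec]) (auto intro!: arg_cong[of _ _ "\<lambda>v. conc x 0 v (?w ?n)"])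
    qed auto
    have e: "?v ?n = ?u 0" "?u ?n = v" using v0 by auto
    have "poly q B + (?n * (?t + 2) + 1 + (?n * (1 + 2) + 1)) \<le> poly ?p B"
    proof -
      have "?n * (?t + 2) \<le> poly s B * (?t + 2)" "?n * 3 \<le> poly s B * 3"
        by (rule mult_le_mono1[OF n])+
      then show ?thesis by (simp add: poly_pcompose algebra_simps)
    qed
    then show ?thesis
      using runs_Seq[OF 1 runs_Seq[OF 2[unfolded e] 3[unfolded e]]]
      by (auto elim!: runs_weaken)
  qed
  then show ?case unfolding emits_within_def by blast
next
  case (IfIn j t e f)
  then obtain p q where ind: "emits_within e p" "emits_within f q" by blast
  note p = emits_withinD[OF ind(1)] and q = emits_withinD[OF ind(2)]
  have "runs A (emitter (IfIn j t e f)) (conc x 0 v w) (poly ([:4, 10:] + p + q) B)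
      (conc x 0 v (w @ em (IfIn j t e f) x v))"
    if X: "X \<subseteq> {..<d}" and wf: "wf_emit X d (IfIn j t e f)" and v: "\<forall>k\<ge>d. v k = 0"
      and B: "\<forall>k\<in>X. v k \<le> B" for A x v w X d B
  proof -
    have jt: "j \<noteq> t" "v t = 0" "v j \<le> B" using wf X v B by auto
    let ?v = "\<lambda>i. v(j := v j - i, t := i)"
    let ?u = "\<lambda>i. v(j := i, t := v j - i)"
    have 1: "runs A (loop j (dec j ;; inc t ;; move0 MoveR)) (conc x 0 (?v 0) w) (v j * (3 + 2) + 1)
      (conc x (v j) (?v (v j)) w)"
    proof (rule runs_loop[where v = ?v and h = "\<lambda>i. i" and w = "\<lambda>_. w"])
      fix i assume "i < v j"
      then show "runs A (dec j ;; inc t ;; move0 MoveR) (conc x i (?v i) w) 3 (conc x (Suc i) (?v (Suc i)) w)"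
        using jt
        by (intro runs_weaken[OF runs_Seq[OF runs_dec runs_Seq[OF runs_inc runs_right]]])
          (auto intro!: arg_cong[of _ _ "\<lambda>v. conc x _ v w"])
    qed (use jt in auto)
    have 2: "runs A (loop t (dec t ;; inc j ;; move0 MoveL)) (conc x (v j - 0) (?u 0) w) (v j * (3 + 2) + 1)
      (conc x (v j - v j) (?u (v j)) w)"
    proof (rule runs_loop[where v = ?u and h = "\<lambda>i. v j - i" and w = "\<lambda>_. w"])
      fix i assume "i < v j"
      then show "runs A (dec t ;; inc j ;; move0 MoveL) (conc x (v j - i) (?u i) w) 3
          (conc x (v j - Suc i) (?u (Suc i)) w)"
        using jt
        by (intro runs_weaken[OF runs_Seq[OF runs_dec runs_Seq[OF runs_inc runs_left]]])
          (auto intro!: arg_cong[of _ _ "\<lambda>v. conc x _ v w"])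
    qed (use jt in auto)
    have go: "runs A (loop j (dec j ;; inc t ;; move0 MoveR)) (conc x 0 v w) (v j * 5 + 1)
        (conc x (v j) (?u 0) w)"
      using 1 by (simp add: fun_upd_idem[of v t, OF jt(2)])
    have rest: "runs A (loop t (dec t ;; inc j ;; move0 MoveL)) (conc x (v j) (?u 0) w)
        (v j * 5 + 1) (conc x 0 v w)"
      using 2 by (simp add: fun_upd_idem[of v t, OF jt(2)])
    have "runs A (Branch 0 (\<lambda>y. y = Some True)
       (loop t (dec t ;; inc j ;; move0 MoveL) ;; emitter e)
       (loop t (dec t ;; inc j ;; move0 MoveL) ;; emitter f)) (conc x (v j) (?u 0) w)
       (v j * 5 + 1 + (poly p B + poly q B) + 2) (conc x 0 v (w @ em (IfIn j t e f) x v))"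
    proof (rule runs_Branch)
      assume "rd (conc x (v j) (?u 0) w) 0 = Some True"
      then have "em (IfIn j t e f) x v = em e x v" by (auto simp: rd_conc_0 split: if_splits)
      then show "runs A (loop t (dec t ;; inc j ;; move0 MoveL) ;; emitter e) (conc x (v j) (?u 0) w)
          (v j * 5 + 1 + (poly p B + poly q B)) (conc x 0 v (w @ em (IfIn j t e f) x v))"
        using wf by (intro runs_weaken[OF runs_Seq[OF rest p[OF X _ v B]]]) auto
    next
      assume "rd (conc x (v j) (?u 0) w) 0 \<noteq> Some True"
      then have "em (IfIn j t e f) x v = em f x v" by (auto simp: rd_conc_0)
      then show "runs A (loop t (dec t ;; inc j ;; move0 MoveL) ;; emitter f) (conc x (v j) (?u 0) w)
          (v j * 5 + 1 + (poly p B + poly q B)) (conc x 0 v (w @ em (IfIn j t e f) x v))"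
        using wf by (intro runs_weaken[OF runs_Seq[OF rest q[OF X _ v B]]]) auto
    qed
    from runs_Seq[OF go this] show ?thesis
      using jt(3) by (auto elim!: runs_weaken)
  qed
  then show ?case unfolding emits_within_def by blast
qed


section \<open>Binary search with the oracle\<close>

lemma tape_word_word_tape: "tape_word (word_tape w) = w"
proof -
  have "(LEAST n. word_tape w (int n) = None) = length w"
    by (rule Least_equality) (auto simp: word_tape_def split: if_splits)
  then show ?thesis
    by (auto simp: tape_word_def word_tape_def intro!: nth_equalityI)
qed

lemma word_tape_Nil: "word_tape [] = (\<lambda>_. None)"
  by (auto simp: word_tape_def)

lemma word_tape_upd: "(word_tape (a @ y # c))(int (length a) := Some z) = word_tape (a @ z # c)"
proof
  fix i show "((word_tape (a @ y # c))(int (length a) := Some z)) i = word_tape (a @ z # c) i"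
    by (cases "nat i - length a") (auto simp: word_tape_def nth_append nth_Cons')
qed

lemma word_tape_erase: "(word_tape (a @ [y]))(int (length a) := None) = word_tape a"
  by (auto simp: word_tape_def fun_eq_iff nth_append nat_less_iff)

lemma nat_bits_0 [simp]: "nat_bits 0 = []"
  by (simp add: nat_bits.simps)

lemma nat_bits_odd: "nat_bits (Suc (2 * n)) = True # nat_bits n"
  by (subst nat_bits.simps) simp

lemma nat_bits_even: "nat_bits (2 * n) = (if n = 0 then [] else False # nat_bits n)"
  by (subst nat_bits.simps) simp

lemma nat_bits_eq_Nil: "nat_bits n = [] \<longleftrightarrow> n = 0"
  by (subst nat_bits.simps) simp

lemma nat_bits_ones: "nat_bits (2 ^ j * u + (2 ^ j - 1)) = replicate j True @ nat_bits u"
proof (induction j)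
  case (Suc j)
  obtain k where "(2 :: nat) ^ j = Suc k" using not0_implies_Suc[of "2 ^ j"] by auto
  then have "2 ^ Suc j * u + (2 ^ Suc j - 1) = Suc (2 * (2 ^ j * u + (2 ^ j - 1 :: nat)))"
    by (simp add: algebra_simps)
  then show ?case using Suc by (simp only: nat_bits_odd) simp
qed simp

lemma length_nat_bits: "n < 2 ^ k \<Longrightarrow> length (nat_bits n) \<le> k"
proof (induction k arbitrary: n)
  case (Suc k)
  then show ?case using Suc.IH[of "n div 2"] by (subst nat_bits.simps) auto
qed simp

text \<open>With \<open>q = N div 2 ^ j\<close>, the probe is the largest number whose quotient by
  \<open>2 ^ j\<close> is \<open>q\<close> with its last bit cleared. So \<open>N\<close> exceeds
  the probe exactly if that bit is 1.\<close>

lemma le_probe_iff: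
  fixes N :: nat
  shows "N \<le> 2 ^ j * (2 * (N div 2 ^ Suc j)) + (2 ^ j - 1) \<longleftrightarrow> even (N div 2 ^ j)"
proof -
  define q r where "q = N div 2 ^ j" and "r = N mod 2 ^ j"
  have N: "N = 2 ^ j * q + r" and r: "r < 2 ^ j" by (auto simp: q_def r_def)
  have d: "N div 2 ^ Suc j = q div 2"
    unfolding q_def by (metis div_mult2_eq power_Suc2)
  show ?thesis
  proof (cases "even q")
    case True
    then show ?thesis using r unfolding d q_def[symmetric] by (simp add: N)
  next
    case False
    then have q: "q = 2 * (q div 2) + 1" by presburger
    have "2 ^ j * q = 2 ^ j * (2 * (q div 2)) + 2 ^ j"
      using arg_cong[OF q, of "\<lambda>a. 2 ^ j * a"] by (simp add: algebra_simps)
    moreover have "(1 :: nat) \<le> 2 ^ j" by simp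
    ultimately have "\<not> N \<le> 2 ^ j * (2 * (q div 2)) + (2 ^ j - 1)" using N by linarith
    then show ?thesis using False unfolding d q_def[symmetric] by simp
  qed
qed

section \<open>The search and the copying of its result\<close>

definition gmem :: "bool list \<Rightarrow> (nat \<Rightarrow> nat) \<Rightarrow> (int \<Rightarrow> sym) \<Rightarrow> int \<Rightarrow> (int \<Rightarrow> sym) \<Rightarrow> int \<Rightarrow>
    (int \<Rightarrow> sym) \<Rightarrow> mem" where
  "gmem x v t1 p1 t2 p2 t3 = (conc x 0 v [])(1 := (t1, p1), 2 := (t2, p2), 3 := (t3, 0))"

lemma conc_gmem: "conc x 0 v w = gmem x v (\<lambda>_. None) 0 (word_tape w) (int (length w)) (\<lambda>_. None)"
  by (auto simp: gmem_def conc_def fun_eq_iff)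

lemma rd_gmem:
  "rd (gmem x v t1 p1 t2 p2 t3) 2 = t2 p2" "rd (gmem x v t1 p1 t2 p2 t3) 3 = t3 0"
  "rd (gmem x v t1 p1 t2 p2 t3) 5 = (if v 1 = 0 then Some True else None)"
  by (auto simp: gmem_def rd_def conc_def ctr_def)

lemma runs_gmem1: "t1(p1 := fst (f (t1 p1))) = t1' \<Longrightarrow> p1 + dir_offset (snd (f (t1 p1))) = p1' \<Longrightarrow>
  runs A (Act 1 f) (gmem x v t1 p1 t2 p2 t3) 1 (gmem x v t1' p1' t2 p2 t3)"
  by (rule runs_weaken[OF runs_Act]) (auto simp: act_def gmem_def rd_def fun_eq_iff)

lemma runs_gmem2: "t2(p2 := fst (f (t2 p2))) = t2' \<Longrightarrow> p2 + dir_offset (snd (f (t2 p2))) = p2' \<Longrightarrow>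
  runs A (Act 2 f) (gmem x v t1 p1 t2 p2 t3) 1 (gmem x v t1 p1 t2' p2' t3)"
  by (rule runs_weaken[OF runs_Act]) (auto simp: act_def gmem_def rd_def fun_eq_iff)

lemma runs_gmem3: "t3(0 := y) = t3' \<Longrightarrow>
  runs A (Act 3 (\<lambda>_. (y, Stay))) (gmem x v t1 p1 t2 p2 t3) 1 (gmem x v t1 p1 t2 p2 t3')"
  by (rule runs_weaken[OF runs_Act]) (auto simp: act_def gmem_def rd_def fun_eq_iff)

lemma runs_gmem_dec:
  assumes "0 < v r" "v' = v(r := v r - 1)"
  shows "runs A (dec r) (gmem x v t1 p1 t2 p2 t3) 1 (gmem x v' t1 p1 t2 p2 t3)"
  unfolding dec_def assms(2)
  by (rule runs_weaken[OF runs_Act])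
    (use assms(1) in \<open>auto simp: act_def gmem_def rd_def conc_def ctr_def fun_eq_iff\<close>)

lemma runs_gmem_query: "(\<lambda>_. None)(0 := Some (tape_word t2 \<in> A)) = t3 \<Longrightarrow>
  runs A Query (gmem x v t1 p1 t2 p2 (\<lambda>_. None)) 3 (gmem x v t1 p1 t2 p2 t3)"
  by (rule runs_weaken[OF runs_Query]) (auto simp: act_def gmem_def rd_def fun_eq_iff)

text \<open>Since digits are written lowest first, the undetermined digits lie between the circuit
  and the known digits. On entry the head is just behind the undetermined ones, and a blank there
  means that no nonzero digit is known yet. Only the cell to its left is rewritten in this
  round.\<close>

definition search_body :: com where
  "search_body = dec 1 ;;
     Branch 2 (\<lambda>y. y = None)
       (Act 2 (\<lambda>y. (y, MoveL)) ;; Act 2 (\<lambda>_. (None, Stay)))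
       (Act 2 (\<lambda>y. (y, MoveL)) ;; Act 2 (\<lambda>_. (Some False, Stay))) ;;
     Query ;;
     Branch 3 (\<lambda>y. y = Some False) (Act 2 (\<lambda>_. (Some True, Stay))) Skip ;;
     Act 3 (\<lambda>_. (None, Stay))"

definition copy_body :: com where
  "copy_body = Branch 2 (\<lambda>y. y = Some True) (Act 1 (\<lambda>_. (Some True, MoveR))) (Act 1 (\<lambda>_. (Some False, MoveR))) ;;
     Act 2 (\<lambda>y. (y, MoveR))"

text \<open>The digits of \<open>N\<close> are found from the top. Digit \<open>j\<close> is 0 iff \<open>N\<close> is at most the number
  with the known higher digits, 0 at \<open>j\<close> and 1 below. As a code has no leading zeros, this 0 is
  left blank as long as all higher digits are 0.\<close>

lemma runs_search_body:
  assumes orc: "\<And>s. b @ nat_bits s \<in> A \<longleftrightarrow> N \<le> s" and v: "v 1 = Suc i"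
  shows "runs A search_body
    (gmem x v (\<lambda>_. None) 0 (word_tape (b @ replicate (Suc j) True @ nat_bits (N div 2 ^ Suc j)))
      (int (length b + Suc j)) (\<lambda>_. None)) 12
    (gmem x (v(1 := i)) (\<lambda>_. None) 0 (word_tape (b @ replicate j True @ nat_bits (N div 2 ^ j)))
      (int (length b + j)) (\<lambda>_. None))"
proof -
  define U where "U = nat_bits (N div 2 ^ Suc j)"
  define w where "w = b @ replicate j True"
  let ?s = "2 ^ j * (2 * (N div 2 ^ Suc j)) + (2 ^ j - 1)"
  let ?q = "N div 2 ^ j"
  have q2: "?q div 2 = N div 2 ^ Suc j" by (metis div_mult2_eq power_Suc2)
  have lw: "length w = length b + j" by (simp add: w_def)
  have tp: "b @ replicate (Suc j) True @ U = w @ True # U"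
    by (simp add: w_def replicate_append_same replicate_app_Cons_same)
  define w' where "w' = b @ nat_bits ?s"
  have w': "w' = w @ (if U = [] then [] else False # U)"
    unfolding w'_def nat_bits_ones nat_bits_even by (simp add: U_def w_def nat_bits_eq_Nil)
  let ?t = "word_tape (w @ True # U)"
  have pos: "?t (int (length b + Suc j)) = None \<longleftrightarrow> U = []"
    by (auto simp: word_tape_def lw)
  have left: "runs A (Act 2 (\<lambda>y. (y, MoveL)))
      (gmem x (v(1 := i)) (\<lambda>_. None) 0 ?t (int (length b + Suc j)) (\<lambda>_. None)) 1
      (gmem x (v(1 := i)) (\<lambda>_. None) 0 ?t (int (length w)) (\<lambda>_. None))"
    by (rule runs_gmem2) (simp_all add: lw)
  have 1: "runs A (dec 1) (gmem x v (\<lambda>_. None) 0 ?t (int (length b + Suc j)) (\<lambda>_. None)) 1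
      (gmem x (v(1 := i)) (\<lambda>_. None) 0 ?t (int (length b + Suc j)) (\<lambda>_. None))"
    by (rule runs_gmem_dec) (use v in simp_all)
  have 2: "runs A (Branch 2 (\<lambda>y. y = None)
       (Act 2 (\<lambda>y. (y, MoveL)) ;; Act 2 (\<lambda>_. (None, Stay)))
       (Act 2 (\<lambda>y. (y, MoveL)) ;; Act 2 (\<lambda>_. (Some False, Stay))))
      (gmem x (v(1 := i)) (\<lambda>_. None) 0 ?t (int (length b + Suc j)) (\<lambda>_. None)) (1 + 1 + 2)
      (gmem x (v(1 := i)) (\<lambda>_. None) 0 (word_tape w') (int (length w)) (\<lambda>_. None))"
    by (rule runs_Branch; rule runs_Seq[OF left]; rule runs_gmem2)
      (auto simp: rd_gmem pos[simplified] w' word_tape_erase word_tape_upd)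
  let ?a = "even ?q"
  have ans: "tape_word (word_tape w') \<in> A \<longleftrightarrow> ?a"
    unfolding tape_word_word_tape w'_def orc by (rule le_probe_iff)
  have 3: "runs A Query (gmem x (v(1 := i)) (\<lambda>_. None) 0 (word_tape w') (int (length w)) (\<lambda>_. None)) 3
      (gmem x (v(1 := i)) (\<lambda>_. None) 0 (word_tape w') (int (length w)) ((\<lambda>_. None)(0 := Some ?a)))"
    by (rule runs_gmem_query) (simp add: ans)
  let ?w'' = "w @ nat_bits ?q"
  have even: "?w'' = w'" if ?a
  proof -
    let ?h = "N div 2 ^ Suc j"
    have "?q = 2 * ?h" using that by (metis dvd_mult_div_cancel q2)
    then have "nat_bits ?q = (if ?h = 0 then [] else False # nat_bits ?h)"
      by (simp only: nat_bits_even)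
    then show ?thesis unfolding w' U_def nat_bits_eq_Nil by simp
  qed
  have odd: "?w'' = w @ True # U" if "\<not> ?a"
  proof -
    have "?q = Suc (2 * (?q div 2))" using odd_two_times_div_two_succ[OF that] by simp
    then have "nat_bits ?q = True # nat_bits (?q div 2)" by (metis nat_bits_odd)
    then show ?thesis unfolding q2 U_def by simp
  qed
  have odd_upd: "(word_tape w')(int (length w) := Some True) = word_tape ?w''" if "\<not> ?a"
    unfolding odd[OF that] w' by (auto simp: word_tape_snoc word_tape_upd)
  have 4: "runs A (Branch 3 (\<lambda>y. y = Some False) (Act 2 (\<lambda>_. (Some True, Stay))) Skip)
      (gmem x (v(1 := i)) (\<lambda>_. None) 0 (word_tape w') (int (length w)) ((\<lambda>_. None)(0 := Some ?a))) (1 + 2)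
      (gmem x (v(1 := i)) (\<lambda>_. None) 0 (word_tape ?w'') (int (length w)) ((\<lambda>_. None)(0 := Some ?a)))"
  proof (rule runs_Branch)
    assume "rd (gmem x (v(1 := i)) (\<lambda>_. None) 0 (word_tape w') (int (length w)) ((\<lambda>_. None)(0 := Some ?a))) 3
      = Some False"
    then have "\<not> ?a" by (simp add: rd_gmem)
    then show "runs A (Act 2 (\<lambda>_. (Some True, Stay)))
      (gmem x (v(1 := i)) (\<lambda>_. None) 0 (word_tape w') (int (length w)) ((\<lambda>_. None)(0 := Some ?a))) 1
      (gmem x (v(1 := i)) (\<lambda>_. None) 0 (word_tape ?w'') (int (length w)) ((\<lambda>_. None)(0 := Some ?a)))"
      by (intro runs_gmem2) (simp_all add: odd_upd)
  next
    assume "rd (gmem x (v(1 := i)) (\<lambda>_. None) 0 (word_tape w') (int (length w)) ((\<lambda>_. None)(0 := Some ?a))) 3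
      \<noteq> Some False"
    then have ?a by (simp add: rd_gmem)
    then show "runs A Skip
      (gmem x (v(1 := i)) (\<lambda>_. None) 0 (word_tape w') (int (length w)) ((\<lambda>_. None)(0 := Some ?a))) 1
      (gmem x (v(1 := i)) (\<lambda>_. None) 0 (word_tape ?w'') (int (length w)) ((\<lambda>_. None)(0 := Some ?a)))"
      by (intro runs_weaken[OF runs_Skip]) (simp_all add: even)
  qed
  have 5: "runs A (Act 3 (\<lambda>_. (None, Stay)))
      (gmem x (v(1 := i)) (\<lambda>_. None) 0 (word_tape ?w'') (int (length w)) ((\<lambda>_. None)(0 := Some ?a))) 1
      (gmem x (v(1 := i)) (\<lambda>_. None) 0 (word_tape ?w'') (int (length w)) (\<lambda>_. None))"
    by (rule runs_gmem3) auto
  show ?thesis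
    using runs_Seq[OF 1 runs_Seq[OF 2 runs_Seq[OF 3 runs_Seq[OF 4 5]]]]
    unfolding search_body_def U_def[symmetric] tp by (simp add: w_def)
qed

lemma runs_search:
  assumes orc: "\<And>s. b @ nat_bits s \<in> A \<longleftrightarrow> N \<le> s" and N: "N < 2 ^ k" and v: "v 1 = k"
  shows "\<exists>s'. runs A (loop 1 search_body ;; While 2 (\<lambda>y. y \<noteq> None) copy_body)
    (conc x 0 v (b @ replicate k True)) (20 * k + 2) s' \<and> tape_word (fst (s' 1)) = nat_bits N"
proof -
  let ?S = "\<lambda>i. gmem x (v(1 := k - i)) (\<lambda>_. None) 0
    (word_tape (b @ replicate (k - i) True @ nat_bits (N div 2 ^ (k - i))))
    (int (length b + (k - i))) (\<lambda>_. None)"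
  have "runs A (loop 1 search_body) (?S 0) (k * (12 + 2) + 1) (?S k)"
    unfolding loop_def
  proof (rule runs_While)
    fix i assume i: "i < k"
    then have "k - i = Suc (k - Suc i)" by simp
    then show "runs A search_body (?S i) 12 (?S (Suc i))"
      using runs_search_body[OF orc, of "v(1 := k - i)" "k - Suc i" x "k - Suc i"] by simp
  qed (auto simp: rd_gmem)
  moreover have "?S 0 = conc x 0 v (b @ replicate k True)"
    using N v by (simp add: conc_gmem fun_upd_idem)
  ultimately have 1: "runs A (loop 1 search_body) (conc x 0 v (b @ replicate k True)) (k * 14 + 1) (?S k)"
    by simp
  let ?u = "nat_bits N"
  let ?T = "\<lambda>i. gmem x (v(1 := 0)) (word_tape (take i ?u)) (int i) (word_tape (b @ ?u))
    (int (length b + i)) (\<lambda>_. None)"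
  have 2: "runs A (While 2 (\<lambda>y. y \<noteq> None) copy_body) (?T 0) (length ?u * (4 + 2) + 1) (?T (length ?u))"
  proof (rule runs_While)
    fix i assume i: "i < length ?u"
    have nth: "word_tape (b @ ?u) (int (length b + i)) = Some (?u ! i)"
      using i by (simp add: word_tape_def nat_add_distrib nth_append)
    then show "rd (?T i) 2 \<noteq> None" by (simp add: rd_gmem)
    have upd: "(word_tape (take i ?u))(int i := Some (?u ! i)) = word_tape (take (Suc i) ?u)"
      using i word_tape_snoc[of "take i ?u" "?u ! i"] by (simp add: take_Suc_conv_app_nth)
    let ?T' = "gmem x (v(1 := 0)) (word_tape (take (Suc i) ?u)) (int (Suc i)) (word_tape (b @ ?u))
      (int (length b + i)) (\<lambda>_. None)"
    have "runs A (Branch 2 (\<lambda>y. y = Some True) (Act 1 (\<lambda>_. (Some True, MoveR))) (Act 1 (\<lambda>_. (Some False, MoveR))))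
       (?T i) (1 + 2) ?T'"
      by (rule runs_Branch; rule runs_gmem1) (use upd in \<open>simp_all add: rd_gmem nth[simplified]\<close>)
    moreover have "runs A (Act 2 (\<lambda>y. (y, MoveR))) ?T' 1 (?T (Suc i))"
      by (rule runs_gmem2) (simp_all)
    ultimately show "runs A copy_body (?T i) 4 (?T (Suc i))"
      unfolding copy_body_def by (rule runs_weaken[OF runs_Seq]) simp_all
  qed (simp add: rd_gmem word_tape_def)
  \<comment> \<open>The search ends with the head on the lowest digit, so copying starts in place.
    Searching takes 14 steps per digit and copying 6, with at most \<open>k\<close> digits to
    copy.\<close>
  have "?T 0 = ?S k" by (simp add: word_tape_Nil)
  then have "runs A (loop 1 search_body ;; While 2 (\<lambda>y. y \<noteq> None) copy_body)
      (conc x 0 v (b @ replicate k True)) (20 * k + 2) (?T (length ?u))"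
    using runs_Seq[OF 1 2[unfolded \<open>?T 0 = ?S k\<close>]] length_nat_bits[OF N]
    by (auto elim!: runs_weaken)
  moreover have "fst (?T (length ?u) 1) = word_tape ?u" by (simp add: gmem_def)
  ultimately show ?thesis using tape_word_word_tape by metis
qed

text \<open>Counter 0 keeps the length of the input, the only free variable of the printed
  expressions; counter 1 serves to rewind the head.\<close>

definition measure_input :: com where
  "measure_input = While 0 (\<lambda>y. y \<noteq> None) (move0 MoveR ;; inc 0 ;; inc 1) ;;
     loop 1 (dec 1 ;; move0 MoveL)"

lemma runs_measure_input:
  "runs A measure_input (init_mem x) (9 * length x + 2) (conc x 0 ((\<lambda>_. 0)(0 := length x)) [])"
proof -
  let ?n = "length x"
  let ?v = "\<lambda>i. (\<lambda>_ :: nat. 0)(0 := i, 1 := i)"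
  let ?u = "\<lambda>i. (\<lambda>_ :: nat. 0)(0 := ?n, 1 := ?n - i)"
  have 1: "runs A (While 0 (\<lambda>y. y \<noteq> None) (move0 MoveR ;; inc 0 ;; inc 1)) (conc x 0 (?v 0) [])
      (?n * (3 + 2) + 1) (conc x ?n (?v ?n) [])"
  proof (rule runs_While[where S = "\<lambda>i. conc x i (?v i) []"])
    fix i
    show "runs A (move0 MoveR ;; inc 0 ;; inc 1) (conc x i (?v i) []) 3 (conc x (Suc i) (?v (Suc i)) [])"
      by (rule runs_weaken[OF runs_Seq[OF runs_right runs_Seq[OF runs_inc runs_inc]]])
        (auto intro!: arg_cong[of _ _ "\<lambda>v. conc x (Suc i) v []"])
  qed (auto simp: rd_conc_0)
  have 2: "runs A (loop 1 (dec 1 ;; move0 MoveL)) (conc x (?n - 0) (?u 0) []) (?n * (2 + 2) + 1)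
      (conc x (?n - ?n) (?u ?n) [])"
  proof (rule runs_loop[where h = "\<lambda>i. ?n - i" and v = ?u and w = "\<lambda>_. []"])
    fix i assume "i < ?n"
    then show "runs A (dec 1 ;; move0 MoveL) (conc x (?n - i) (?u i) []) 2 (conc x (?n - Suc i) (?u (Suc i)) [])"
      by (intro runs_weaken[OF runs_Seq[OF runs_dec runs_left]])
        (auto intro!: arg_cong[of _ _ "\<lambda>v. conc x _ v []"])
  qed auto
  have "init_mem x = conc x 0 (?v 0) []"
    by (auto simp: init_mem_def conc_def fun_eq_iff word_tape_def)
  moreover have "?u ?n = (\<lambda>_. 0)(0 := ?n)" by (auto simp: fun_eq_iff)
  ultimately show ?thesis
    using runs_Seq[OF 1, of "loop 1 (dec 1 ;; move0 MoveL)" "?n * (2 + 2) + 1" "conc x 0 ((\<lambda>_. 0)(0 := ?n)) []"] 2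
    unfolding measure_input_def by (auto elim!: runs_weaken)
qed

text \<open>The ones emitted after the code of the circuit are the digits below the first probe.\<close>

lemma search_FP_oracle:
  assumes wf: "wf_emit {0} 1 e" "avars a \<subseteq> {0}"
    and em: "\<And>x v. v 0 = length x \<Longrightarrow> em e x v = b x @ replicate (aval a v) True"
    and orc: "\<And>x s. b x @ nat_bits s \<in> A \<longleftrightarrow> f x \<le> s"
    and bound: "\<And>x v. v 0 = length x \<Longrightarrow> f x < 2 ^ aval a v"
  shows "(\<lambda>x. nat_bits (f x)) \<in> FP_oracle A"
proof -
  obtain p where p: "emits_within e p" using emitter_runs by blast
  obtain q where q: "adds_within a q" using addto_runs by blast
  obtain s :: "nat poly" where s: "\<And>v B. \<forall>k\<in>avars a. v k \<le> B \<Longrightarrow> aval a v \<le> poly s B"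
    using aval_bound[of a] by blast
  define c where "c = measure_input ;; emitter e ;; addto 2 a 1 ;; loop 1 search_body ;;
    While 2 (\<lambda>y. y \<noteq> None) copy_body"
  have "queries c = 1"
    by (simp add: c_def measure_input_def search_body_def copy_body_def loop_def inc_def dec_def move0_def)
  then obtain M where M: "wf_otm M"
    and comp: "\<And>A x t s' T. exec A c (init_mem x) t s' \<Longrightarrow> t + 2 \<le> T \<Longrightarrow>
      computes_within M A x T (tape_word (fst (s' 1)))"
    using com_machine by blast
  \<comment> \<open>The summands are the times for measuring the input, printing, computing the
    number of digits and searching; the last 2 are the entry and exit steps of the machine.\<close>
  define P where "P = [:2, 9:] + (p + (q + ([:20:] * s + [:2:]))) + [:2:]"
  have "computes_within M A x (poly P (length x)) (nat_bits (f x))" for x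
  proof -
    let ?v = "(\<lambda>_. 0)(0 := length x)"
    let ?k = "aval a ?v"
    let ?w = "b x @ replicate ?k True"
    have 1: "runs A measure_input (init_mem x) (9 * length x + 2) (conc x 0 ?v [])"
      by (rule runs_measure_input)
    have 2: "runs A (emitter e) (conc x 0 ?v []) (poly p (length x)) (conc x 0 ?v ?w)"
      using emits_withinD[OF p _ wf(1), of ?v "length x" A x "[]"] em[of ?v x] by simp
    have "avars a \<subseteq> {..<1}" "\<forall>k\<in>avars a. ?v k \<le> length x" using wf(2) by auto
    then have 3: "runs A (addto 2 a 1) (conc x 0 ?v ?w) (poly q (length x)) (conc x 0 (?v(1 := ?k)) ?w)"
      using adds_withinD[OF q, of 1 2 ?v "length x" A x 0 ?w] by simp
    obtain s' where 4: "runs A (loop 1 search_body ;; While 2 (\<lambda>y. y \<noteq> None) copy_body)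
        (conc x 0 (?v(1 := ?k)) ?w) (20 * ?k + 2) s'" and out: "tape_word (fst (s' 1)) = nat_bits (f x)"
      using runs_search[OF orc bound[of ?v x], of "?v(1 := ?k)" x] by auto
    from runs_Seq[OF 1 runs_Seq[OF 2 runs_Seq[OF 3 4]]]
    obtain t where t: "exec A c (init_mem x) t s'"
      "t \<le> 9 * length x + 2 + (poly p (length x) + (poly q (length x) + (20 * ?k + 2)))"
      unfolding runs_def c_def by blast
    have "?k \<le> poly s (length x)" using s[of ?v "length x"] wf(2) by auto
    then have "t + 2 \<le> poly P (length x)" using t(2) by (simp add: P_def algebra_simps)
    from comp[OF t(1) this] out show ?thesis by simp
  qed
  with M show ?thesis unfolding FP_oracle_def by blast
qed


section \<open>Writing the tableau circuit\<close>

definition Cats :: "emit list \<Rightarrow> emit" where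
  "Cats es = foldr Cat es ESkip"

lemma em_Cats [simp]: "em (Cats es) x v = concat (map (\<lambda>e. em e x v) es)"
  unfolding Cats_def by (induction es) auto

lemma wf_Cats [simp]: "wf_emit X d (Cats es) \<longleftrightarrow> (\<forall>e\<in>set es. wf_emit X d e)"
  unfolding Cats_def by (induction es) auto

definition emit_unary :: "nat \<Rightarrow> aexp \<Rightarrow> emit" where
  "emit_unary d a = Cat (Loop d a (Bit True)) (Bit False)"

lemma em_unary [simp]: "em (emit_unary d a) x v = unary (aval a v)"
  by (simp add: emit_unary_def unary_def map_replicate_const)

lemma wf_unary [simp]: "wf_emit X d (emit_unary d a) \<longleftrightarrow> avars a \<subseteq> X"
  by (simp add: emit_unary_def)

definition port_exp :: "(nat \<Rightarrow> aexp) \<Rightarrow> port \<Rightarrow> aexp" where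
  "port_exp b p = Plus (b (fst p)) (Cst (snd p))"

fun emit_gate :: "nat \<Rightarrow> (nat \<Rightarrow> aexp) \<Rightarrow> tgate \<Rightarrow> emit" where
  "emit_gate d b TOne = Cats [Bit False, Bit False]"
| "emit_gate d b (TAnd p q) =
     Cats [Bit True, Bit False, emit_unary d (port_exp b p), emit_unary d (port_exp b q)]"
| "emit_gate d b (TXor p q) =
     Cats [Bit True, Bit True, emit_unary d (port_exp b p), emit_unary d (port_exp b q)]"

definition emit_block :: "nat \<Rightarrow> (nat \<Rightarrow> aexp) \<Rightarrow> tgate list \<Rightarrow> emit" where
  "emit_block d b T = Cats (map (emit_gate d b) T)"

definition enc_gates :: "gate list \<Rightarrow> bool list" where
  "enc_gates gs = concat (map enc_gate gs)"

lemma enc_gates_Nil: "enc_gates [] = []"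
  by (simp add: enc_gates_def)

lemma enc_gates_append: "enc_gates (gs @ hs) = enc_gates gs @ enc_gates hs"
  by (simp add: enc_gates_def)

lemma enc_gates_concat: "enc_gates (concat bs) = concat (map enc_gates bs)"
  by (induction bs) (auto simp: enc_gates_def)

lemma em_gate: "em (emit_gate d b g) x v = enc_gate (inst (\<lambda>j. aval (b j) v) g)"
  by (cases g) (simp_all add: port_exp_def wire_def)

lemma em_block [simp]:
  "em (emit_block d b T) x v = enc_gates (map (inst (\<lambda>j. aval (b j) v)) T)"
  by (simp add: emit_block_def enc_gates_def em_gate comp_def)

lemma wf_block: "(\<And>j. avars (b j) \<subseteq> X) \<Longrightarrow> wf_emit X d (emit_block d b T)"
proof -
  assume "\<And>j. avars (b j) \<subseteq> X"
  then have "wf_emit X d (emit_gate d b g)" for g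
    by (cases g) (simp_all add: port_exp_def)
  then show ?thesis by (auto simp: emit_block_def)
qed

context tableau
begin

section \<open>Address expressions and the printed instance\<close>

context
  fixes mA RA :: aexp
begin

definition widthA :: aexp where
  "widthA = Plus (Plus (Plus RA (Cst 1)) (Plus (Plus (Times (Cst 2) (Var 0)) (Cst 1)) mA)) RA"

definition ibaseA :: "aexp \<Rightarrow> nat \<Rightarrow> aexp" where
  "ibaseA l j = (if j = 1 then l else if j = 2 then Plus mA (Cst 2) else Cst 0)"

text \<open>Variables 1 and 3 are the row and the column.\<close>

definition sbaseA :: "nat \<Rightarrow> aexp" where
  "sbaseA j =
     (if j = 4 then Plus (Plus mA (Cst 2)) (Times (Cst G)
        (Plus (Plus (Plus (Times (Var 1) widthA) widthA) (Var 3)) (Cst 1)))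
      else if j = 3 then Plus (Plus (Plus mA (Cst 2)) (Cst Off)) (Times (Cst G)
        (Plus (Plus (Times (Var 1) widthA) RA) (Cst 1)))
      else Plus (Plus (Plus mA (Cst 2)) (Cst Off)) (Times (Cst G)
        (Plus (Plus (Times (Var 1) widthA) (Var 3)) (Cst j))))"

definition blocksA :: aexp where
  "blocksA = Plus (Plus (Cst 1) widthA) (Times RA widthA)"

definition tbaseA :: "nat \<Rightarrow> aexp" where
  "tbaseA j =
     (if j = 0 then mA else if j = 1 then Plus mA (Cst 1)
      else if j = 3 then Plus (Plus (Plus mA (Cst 2)) (Cst Off)) (Times (Cst G)
        (Plus (Plus (Times RA widthA) RA) (Cst 1)))
      else Plus (Plus mA (Cst 2)) (Times (Cst G) blocksA))"

definition emit_const :: "nat \<Rightarrow> cell \<Rightarrow> emit" where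
  "emit_const d c = emit_block d (ibaseA (Cst 0)) (constT c)"

definition emit_row0 :: emit where
  "emit_row0 = Cats
    [Loop 1 RA (emit_const 3 (cell0 None (-1) False)),
     emit_const 1 (cell0 None 0 True),
     Loop 1 (Var 0) (Cat (emit_const 3 (cell0 (Some True) 1 False))
       (IfIn 1 3 (emit_const 3 (cell0 (Some True) 1 False)) (emit_const 3 (cell0 (Some False) 1 False)))),
     emit_const 1 (cell0 (Some False) 1 False),
     Loop 1 mA (emit_block 3 (ibaseA (Var 1)) varT),
     Loop 1 RA (emit_const 3 (cell0 None 1 False))]"

text \<open>The pieces follow \<open>enc_circuit\<close>, then come the digits for the search. The
  column index is variable 3 because the row loop occupies 1 and 2.\<close>

definition emit_instance :: emit where
  "emit_instance = Cats
    [emit_unary 1 (Plus mA (Cst 2)),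
     emit_unary 1 (Plus (Times (Cst G) blocksA) (Cst (length (bcomp 0 acc)))),
     emit_block 1 (\<lambda>_. Cst 0) (replicate G TOne),
     emit_row0,
     Loop 1 RA (Loop 3 widthA (emit_block 5 sbaseA tg)),
     emit_block 1 tbaseA (bcomp 0 acc),
     emit_unary 1 (Plus (Plus (Plus mA (Cst 1)) (Times (Cst G) blocksA)) (Cst (length (bcomp 0 acc)))),
     Loop 1 (Plus mA (Cst 1)) (Bit True)]"

lemma wf_emit_instance:
  assumes "avars mA \<subseteq> {0}" "avars RA \<subseteq> {0}"
  shows "wf_emit {0} 1 emit_instance"
proof -
  have "avars widthA \<subseteq> {0}" "avars blocksA \<subseteq> {0}"
    using assms by (auto simp: widthA_def blocksA_def)
  moreover have "wf_emit X d (emit_const d c)" if "0 \<in> X" for X d c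
    unfolding emit_const_def using that assms by (intro wf_block) (auto simp: ibaseA_def)
  moreover have "wf_emit {0, 1} 3 (emit_block 3 (ibaseA (Var 1)) varT)"
    using assms by (intro wf_block) (auto simp: ibaseA_def)
  moreover have "wf_emit {0, 1, 3} 5 (emit_block 5 sbaseA tg)"
    using assms calculation(1) by (intro wf_block) (auto simp: sbaseA_def)
  moreover have "wf_emit {0} 1 (emit_block 1 tbaseA (bcomp 0 acc))"
    using assms calculation(1,2) by (intro wf_block) (auto simp: tbaseA_def)
  moreover have "wf_emit {0} 1 (emit_block 1 (\<lambda>_. Cst 0) (replicate G TOne))"
    by (intro wf_block) auto
  ultimately show ?thesis
    using assms by (simp add: emit_instance_def emit_row0_def insert_commute eval_nat_numeral) blast
qed

text \<open>Printing and circuit use the same templates, so each block reduces to the fact that its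
  address expressions evaluate to the intended bases.\<close>

lemma em_emit_instance:
  assumes vars: "avars mA \<subseteq> {0}" "avars RA \<subseteq> {0}" and v: "v 0 = length x"
  shows "em emit_instance x v =
    enc_circuit (tableau_circuit x (aval mA v) (aval RA v)) @ replicate (aval mA v + 1) True"
proof -
  define m R where "m = aval mA v" and "R = aval RA v"
  define W where "W = width (length x) m R"
  have m: "aval mA v' = m" and R: "aval RA v' = R" if "v' 0 = v 0" for v'
    unfolding m_def R_def by (rule aval_cong, use that vars in auto)+
  have W: "aval widthA v' = W" if "v' 0 = v 0" for v'
    using that v by (simp add: widthA_def m R W_def width_def)
  have blocks: "aval blocksA v = 1 + W + R * W"
    by (simp add: blocksA_def W R)
  have const: "em (emit_const d c) x v' = enc_gates (constB m c)" if "v' 0 = v 0" for d c v'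
  proof -
    have "(\<lambda>j. aval (ibaseA (Cst 0) j) v') = ibase m 0"
      using that by (auto simp: ibaseA_def ibase_def m)
    then show ?thesis by (simp add: emit_const_def constB_def)
  qed
  have var: "em (emit_block d (ibaseA (Var 1)) varT) x (v(1 := l)) = enc_gates (varB m l)" for d l
  proof -
    have "(\<lambda>j. aval (ibaseA (Var 1) j) (v(1 := l))) = ibase m l"
      by (auto simp: ibaseA_def ibase_def m)
    then show ?thesis by (simp add: varB_def)
  qed
  have step: "em (emit_block d sbaseA tg) x (v(1 := t, 3 := i)) = enc_gates (stepB m R W t i)" for d t i
  proof -
    have "(\<lambda>j. aval (sbaseA j) (v(1 := t, 3 := i))) = sbase m R W t i"
      by (auto simp: sbaseA_def sbase_def m R W)
    then show ?thesis by (simp add: stepB_def)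
  qed
  have tl: "em (emit_block d tbaseA (bcomp 0 acc)) x v = enc_gates (tail m R W)" for d
  proof -
    have "(\<lambda>j. aval (tbaseA j) v) = tbase m R W"
      by (auto simp: tbaseA_def tbase_def m R W blocks)
    then show ?thesis by (simp add: tail_def)
  qed
  have rep: "concat (map (\<lambda>_. u) [0..<k]) = enc_gates (concat (replicate k b))"
    if "u = enc_gates b" for u b and k :: nat
    unfolding that by (induction k) (simp_all add: enc_gates_Nil enc_gates_append replicate_append_same[symmetric])
  have x: "concat (map (\<lambda>i. f (x ! i)) [0..<length x]) = concat (map f x)" for f :: "bool \<Rightarrow> bool list"
    by (metis (no_types, lifting) map_nth map_map comp_apply map_eq_conv)
  let ?bit = "\<lambda>b. cell0 (Some b) 1 False"
  have row0: "em emit_row0 x v = enc_gates (concat (row0 x m R))"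
  proof -
    have "em (Loop 1 (Var 0) (Cat (emit_const 3 (?bit True))
       (IfIn 1 3 (emit_const 3 (?bit True)) (emit_const 3 (?bit False))))) x v =
      concat (map (\<lambda>i. enc_gates (constB m (?bit True)) @ enc_gates (constB m (?bit (x ! i)))) [0..<length x])"
      by (auto simp: v const intro!: arg_cong[of _ _ concat])
    also have "\<dots> = concat (map (\<lambda>b. enc_gates (constB m (?bit True)) @ enc_gates (constB m (?bit b))) x)"
      by (rule x)
    also have "\<dots> = enc_gates (concat (concat (map (\<lambda>b. [constB m (?bit True), constB m (?bit b)]) x)))"
      by (induction x) (simp_all add: enc_gates_append enc_gates_def)
    finally have word: "em (Loop 1 (Var 0) (Cat (emit_const 3 (?bit True))
       (IfIn 1 3 (emit_const 3 (?bit True)) (emit_const 3 (?bit False))))) x v =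
      enc_gates (concat (concat (map (\<lambda>b. [constB m (?bit True), constB m (?bit b)]) x)))" .
    have reps: "em (Loop 1 RA (emit_const 3 c)) x v = enc_gates (concat (replicate R (constB m c)))" for c
      by (simp add: const R rep)
    have vars: "em (Loop 1 mA (emit_block 3 (ibaseA (Var 1)) varT)) x v =
        enc_gates (concat (map (varB m) [0..<m]))"
      using var[of 3] by (simp add: m enc_gates_concat comp_def del: em_block)
    show ?thesis
      unfolding emit_row0_def em_Cats list.map concat.simps word reps vars
      by (simp add: row0_def const enc_gates_append)
  qed
  have steps: "em (Loop 1 RA (Loop 3 widthA (emit_block 5 sbaseA tg))) x v =
      enc_gates (concat (map (\<lambda>t. concat (map (stepB m R W t) [0..<W])) [0..<R]))"
    using step[of 5] by (simp add: R W enc_gates_concat comp_def del: em_block)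
  have pad: "enc_gates (map (inst b) (replicate G TOne)) = enc_gates (replicate G One)" for b
    by simp
  have digits: "em (Loop 1 (Plus mA (Cst 1)) (Bit True)) x v = replicate (m + 1) True"
    by (simp add: m map_replicate_const)
  have "em emit_instance x v = unary (m + 2) @ unary (G * (1 + W + R * W) + length (bcomp 0 acc)) @
      enc_gates (replicate G One) @ enc_gates (concat (row0 x m R)) @
      enc_gates (concat (map (\<lambda>t. concat (map (stepB m R W t) [0..<W])) [0..<R])) @
      enc_gates (tail m R W) @
      unary (m + 1 + G * (1 + W + R * W) + length (bcomp 0 acc)) @ replicate (m + 1) True"
    using tl[of 1] unfolding emit_instance_def em_Cats list.map concat.simps steps row0 digits
    by (simp add: blocks m)
  also have "\<dots> = enc_circuit (tableau_circuit x m R) @ replicate (m + 1) True"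
    by (simp add: enc_circuit_def tableau_circuit_def Let_def W_def[symmetric] length_tableau_gates
        enc_gates_def[symmetric])
      (simp add: tableau_gates_def Let_def W_def[symmetric] enc_gates_append)
  finally show ?thesis by (simp add: m_def R_def)
qed

end

end

section \<open>Polynomial clocks as expressions, and the reduction\<close>

definition poly_exp :: "nat poly \<Rightarrow> aexp \<Rightarrow> aexp" where
  "poly_exp p a = foldr (\<lambda>c e. Plus (Cst c) (Times a e)) (coeffs p) (Cst 0)"

text \<open>\<open>poly_exp\<close> is Horner's scheme on the list of coefficients.\<close>

lemma aval_poly_exp: "aval (poly_exp p a) v = poly p (aval a v)"
proof -
  have "aval (foldr (\<lambda>c e. Plus (Cst c) (Times a e)) cs (Cst 0)) v = poly (Poly cs) (aval a v)" for cs
    by (induction cs) simp_all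
  then show ?thesis unfolding poly_exp_def by (metis Poly_coeffs)
qed

lemma avars_poly_exp: "avars (poly_exp p a) \<subseteq> avars a"
proof -
  have "avars (foldr (\<lambda>c e. Plus (Cst c) (Times a e)) cs (Cst 0)) \<subseteq> avars a" for cs
    by (induction cs) auto
  then show ?thesis unfolding poly_exp_def .
qed

theorem theorem4: "sharpP_hard NL_C"
  unfolding sharpP_hard_def
proof
  fix f assume "f \<in> sharpP"
  then obtain L and p :: "nat poly" where L: "L \<in> P_class"
    and f: "\<And>x. f x = card {y. length y = poly p (length x) \<and> enc_pair x y \<in> L}"
    unfolding sharpP_def by blast
  from L obtain M and q :: "nat poly" where M: "wf_otm M"
    and q: "\<And>x. computes_within M {} x (poly q (length x)) [x \<in> L]"
    unfolding P_class_def FP_oracle_def by auto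
  obtain K code tg where "tableau M K code tg" using tableau_exists[OF M] by blast
  then interpret tableau M K code tg .
  define mA where "mA = poly_exp p (Var 0)"
  \<comment> \<open>The verifier runs on \<open>enc_pair x y\<close>, of length
    \<open>2 * n + 1 + m\<close> for an input of length \<open>n\<close>. The number of steps is
    twice its clock plus one, as the return of the output head requires.\<close>
  define RA where "RA = Plus (Times (Cst 2)
    (poly_exp q (Plus (Plus (Times (Cst 2) (Var 0)) (Cst 1)) mA))) (Cst 1)"
  define m where "m x = poly p (length x)" for x :: "bool list"
  define R where "R x = 2 * poly q (2 * length x + 1 + m x) + 1" for x :: "bool list"
  have vars: "avars mA \<subseteq> {0}" "avars RA \<subseteq> {0}"
  proof -
    show m: "avars mA \<subseteq> {0}" using avars_poly_exp[of p "Var 0"] by (simp add: mA_def)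
    then show "avars RA \<subseteq> {0}"
      using avars_poly_exp[of q "Plus (Plus (Times (Cst 2) (Var 0)) (Cst 1)) mA"]
      by (auto simp: RA_def)
  qed
  have val: "aval mA v = m x" "aval RA v = R x" if "v 0 = length x" for v x
    using that by (simp_all add: mA_def RA_def m_def R_def aval_poly_exp)
  let ?C = "\<lambda>x. tableau_circuit x (m x) (R x)"
  have NL: "nonlinearity (m x + 2) (circuit_fun (?C x)) = f x" for x
    unfolding f m_def[symmetric]
  proof (rule nonlinearity_eq_count)
    fix y z1 z2 assume y: "length (y :: bool list) = m x"
    have "length (enc_pair x y) = 2 * length x + 1 + m x"
      by (simp add: enc_pair_def y length_concat comp_def sum_list_triv)
    then show "circuit_fun (?C x) (map of_bool y @ [z1, z2]) = of_bool (enc_pair x y \<in> L) * z1 * z2"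
      using q[of "enc_pair x y"] y by (intro tableau_circuit_fun) (simp_all add: R_def)
  qed
  show "(\<lambda>x. nat_bits (f x)) \<in> FP_oracle NL_C"
  proof (rule search_FP_oracle[of "emit_instance mA RA" "Plus mA (Cst 1)" "\<lambda>x. enc_circuit (?C x)"])
    show "wf_emit {0} 1 (emit_instance mA RA)" by (rule wf_emit_instance[OF vars])
    show "avars (Plus mA (Cst 1)) \<subseteq> {0}" using vars by simp
    show "em (emit_instance mA RA) x v = enc_circuit (?C x) @ replicate (aval (Plus mA (Cst 1)) v) True"
      if "v 0 = length x" for x v
      using em_emit_instance[OF vars, where v = v and x = x] that val[of v x] by simp
    show "enc_circuit (?C x) @ nat_bits s \<in> NL_C \<longleftrightarrow> f x \<le> s" for x s
    proof -
      \<comment> \<open>Membership only yields some circuit and target with this code; injectivity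
        of the encoding identifies them.\<close>
      have "enc_instance (?C x) s \<in> NL_C \<longleftrightarrow> nonlinearity (inputs (?C x)) (circuit_fun (?C x)) \<le> s"
        using wf_tableau_circuit by (auto simp: NL_C_def enc_instance_inject)
      also have "inputs (?C x) = m x + 2" by (simp add: tableau_circuit_def Let_def)
      finally show ?thesis by (simp only: NL enc_instance_def)
    qed
    \<comment> \<open>All \<open>2 ^ m x\<close> words may be witnesses, so \<open>m x\<close>
      digits would be one too few.\<close>
    show "f x < 2 ^ aval (Plus mA (Cst 1)) v" if "v 0 = length x" for x v
    proof -
      have "f x \<le> card {y :: bool list. set y \<subseteq> UNIV \<and> length y = m x}"
        unfolding f m_def by (intro card_mono finite_lists_length_eq) auto
      also have "\<dots> = 2 ^ m x" by (subst card_lists_length_eq) simp_all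
      also have "\<dots> < 2 ^ (m x + 1)" by simp
      finally show ?thesis using val[of v x] that by simp
    qed
  qed
qed


end
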